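(* Let $X$ be a Banach lattice and let $A:D(A)\subset X\to X$ be a densely defined resolvent positive operator. Assume that there is $\mu_0>s(A)$ such that for every $\mu\ge\mu_0$ there exists $c>0$ with $$\Vert R(\mu,A)x\Vert\ \ge\ c\,\Vert x\Vert\qquad\text{for all }x\in X_+ .$$ If $B\in\mathcal{L}(X,X_{-1})$ is a positive operator, then $(A_{-1}+B)_{|X}$ generates a positive $C_0$-semigroup on $X$ and $$s\big((A_{-1}+B)_{|X}\big)=\omega_0\big((A_{-1}+B)_{|X}\big).$$
   Context: For a Banach lattice $X$, $X_+$ is its positive cone. $R(\mu,A)=(\mu I-A)^{-1}$ and $s(A)=\sup\{\mathrm{Re}\,\mu:\mu\in\sigma(A)\}$ is the spectral bound. A linear operator $A$ on $X$ is resolvent positive if there is $\omega\in\mathbb{R}$ with $(\omega,\infty)\subset\rho(A)$ and $R(\mu,A)\ge0$ for all $\mu>\omega$. For the generator $G$ of a $C_0$-semigroup $(S(t))_{t\ge0}$, $\omega_0(G)=\inf_{t>0}t^{-1}\log\Vert S(t)\Vert$ is the growth bound. (Under the assumptions of the claim, a known theorem of Arendt shows that $A$ generates a positive $C_0$-semigroup $\mathbb{T}$ on $X$.) $X_{-1}$ is the completion of $X$ for the norm $\Vert x\Vert_{-1}=\Vert R(\mu,A)x\Vert$ ($\mu\in\rho(A)$; different choices give equivalent norms); $A_{-1}$, with domain $X$, is the generator of the unique extension of $\mathbb{T}$ to a $C_0$-semigroup on $X_{-1}$. $X_{-1,+}$ is the closure of $X_+$ in $X_{-1}$, and $B\in\mathcal{L}(X,X_{-1})$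 is positive if $BX_+\subset X_{-1,+}$. $(A_{-1}+B)_{|X}$ denotes the part of $A_{-1}+B$ in $X$: its domain is $\{x\in X: A_{-1}x+Bx\in X\}$ and it acts as $x\mapsto A_{-1}x+Bx$. *)

theory Defs
  imports "HOL-Analysis.Analysis" "HOL-Library.Lattice_Algebras"
begin

class banach_lattice = banach + ordered_real_vector + lattice_ab_group_add_abs +
  assumes norm_mono_abs: "\<bar>x\<bar> \<le> \<bar>y\<bar> \<Longrightarrow> norm x \<le> norm y"

section \<open>Unbounded operators\<close>

text \<open>An unbounded operator is a pair of a domain \<open>D\<close> and a function \<open>A\<close>; the values of \<open>A\<close>
  outside \<open>D\<close> are irrelevant.\<close>

definition linear_operator :: "'a::real_vector set \<Rightarrow> ('a \<Rightarrow> 'a) \<Rightarrow> bool" where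
  "linear_operator D A \<longleftrightarrow> subspace D \<and>
     (\<forall>x\<in>D. \<forall>y\<in>D. A (x + y) = A x + A y) \<and> (\<forall>c. \<forall>x\<in>D. A (c *\<^sub>R x) = c *\<^sub>R A x)"

text \<open>The spectrum of an operator on a real space is that of its complexification. The
  complexification of the space is \<open>'a \<times> 'a\<close>, with \<open>(x, y)\<close> standing for \<open>x + \<i> y\<close>. The product
  norm is equivalent to the usual norms of a complexification, so it yields the same
  resolvent set.\<close>

definition cscale :: "complex \<Rightarrow> 'a::real_vector \<times> 'a \<Rightarrow> 'a \<times> 'a" where
  "cscale \<mu> z = (Re \<mu> *\<^sub>R fst z - Im \<mu> *\<^sub>R snd z, Im \<mu> *\<^sub>R fst z + Re \<mu> *\<^sub>R snd z)"

definition resolvent_set :: "'a::real_normed_vector set \<Rightarrow> ('a \<Rightarrow> 'a) \<Rightarrow> complex set" where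
  "resolvent_set D A = {\<mu>.
     bij_betw (\<lambda>z. cscale \<mu> z - map_prod A A z) (D \<times> D) UNIV \<and>
     bounded_linear (inv_into (D \<times> D) (\<lambda>z. cscale \<mu> z - map_prod A A z))}"

definition spectral_bound :: "'a::real_normed_vector set \<Rightarrow> ('a \<Rightarrow> 'a) \<Rightarrow> ereal" where
  "spectral_bound D A = (SUP \<mu>\<in>- resolvent_set D A. ereal (Re \<mu>))"

definition resolvent :: "'a::real_vector set \<Rightarrow> ('a \<Rightarrow> 'a) \<Rightarrow> real \<Rightarrow> 'a \<Rightarrow> 'a" where
  "resolvent D A \<mu> = inv_into D (\<lambda>x. \<mu> *\<^sub>R x - A x)"

definition resolvent_positive :: "'a::banach_lattice set \<Rightarrow> ('a \<Rightarrow> 'a) \<Rightarrow> bool" where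
  "resolvent_positive D A \<longleftrightarrow> (\<exists>\<omega>. \<forall>\<mu>>\<omega>.
     complex_of_real \<mu> \<in> resolvent_set D A \<and> (\<forall>x\<ge>0. 0 \<le> resolvent D A \<mu> x))"

section \<open>Semigroups\<close>

text \<open>Semigroups are functions on \<open>real\<close>, but only their values at times \<open>t \<ge> 0\<close> matter.\<close>

definition C0_semigroup :: "(real \<Rightarrow> 'a::real_normed_vector \<Rightarrow>\<^sub>L 'a) \<Rightarrow> bool" where
  "C0_semigroup S \<longleftrightarrow> S 0 = id_blinfun \<and>
     (\<forall>s\<ge>0. \<forall>t\<ge>0. S (s + t) = S s o\<^sub>L S t) \<and>
     (\<forall>x. ((\<lambda>t. blinfun_apply (S t) x) \<longlongrightarrow> x) (at_right 0))"

definition positive_semigroup :: "(real \<Rightarrow> 'a::banach_lattice \<Rightarrow>\<^sub>L 'a) \<Rightarrow> bool" where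
  "positive_semigroup S \<longleftrightarrow> (\<forall>t\<ge>0. \<forall>x\<ge>0. 0 \<le> blinfun_apply (S t) x)"

definition gen_dom :: "(real \<Rightarrow> 'a::real_normed_vector \<Rightarrow>\<^sub>L 'a) \<Rightarrow> 'a set" where
  "gen_dom S = {x. \<exists>y. ((\<lambda>t. (blinfun_apply (S t) x - x) /\<^sub>R t) \<longlongrightarrow> y) (at_right 0)}"

definition gen_op :: "(real \<Rightarrow> 'a::real_normed_vector \<Rightarrow>\<^sub>L 'a) \<Rightarrow> 'a \<Rightarrow> 'a" where
  "gen_op S x = Lim (at_right 0) (\<lambda>t. (blinfun_apply (S t) x - x) /\<^sub>R t)"

definition generates ::
    "'a::real_normed_vector set \<Rightarrow> ('a \<Rightarrow> 'a) \<Rightarrow> (real \<Rightarrow> 'a \<Rightarrow>\<^sub>L 'a) \<Rightarrow> bool" where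
  "generates D A S \<longleftrightarrow> C0_semigroup S \<and> D = gen_dom S \<and> (\<forall>x\<in>D. A x = gen_op S x)"

text \<open>The case distinction encodes \<open>log 0 = -\<infinity>\<close>, as the library has \<open>ln 0 = 0\<close>.\<close>

definition growth_bound :: "(real \<Rightarrow> 'a::real_normed_vector \<Rightarrow>\<^sub>L 'a) \<Rightarrow> ereal" where
  "growth_bound S =
     (INF t\<in>{0<..}. if norm (S t) = 0 then -\<infinity> else ereal (ln (norm (S t)) / t))"

section \<open>Extrapolation\<close>

text \<open>The completion \<open>X\<^sub>-\<^sub>1\<close> depends on \<open>A\<close>, so it cannot be a type constructor applied to \<open>'a\<close>.
  It is given up to isometry by a Banach space \<open>'b\<close> and a linear map \<open>J\<close> with dense range
  that is isometric for the norm \<open>\<parallel>R(\<mu>,A)x\<parallel>\<close>. If \<open>D\<close> is dense, then \<open>J = R(\<mu>,A)\<close> with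
  \<open>'b = 'a\<close> is such a completion.\<close>

definition extrapolation_space ::
    "'a::real_normed_vector set \<Rightarrow> ('a \<Rightarrow> 'a) \<Rightarrow> ('a \<Rightarrow> 'b::banach) \<Rightarrow> bool" where
  "extrapolation_space D A J \<longleftrightarrow> linear J \<and> closure (range J) = UNIV \<and>
     (\<exists>\<mu>. complex_of_real \<mu> \<in> resolvent_set D A \<and> (\<forall>x. norm (J x) = norm (resolvent D A \<mu> x)))"

text \<open>Where such semigroups exist, their values at \<open>t \<ge> 0\<close> are uniquely determined, so the choices
  below do not matter.\<close>

definition semigroup_of ::
    "'a::real_normed_vector set \<Rightarrow> ('a \<Rightarrow> 'a) \<Rightarrow> real \<Rightarrow> 'a \<Rightarrow>\<^sub>L 'a" where
  "semigroup_of D A = (SOME S. generates D A S)"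

definition extrapolated_semigroup ::
    "'a::real_normed_vector set \<Rightarrow> ('a \<Rightarrow> 'a) \<Rightarrow> ('a \<Rightarrow> 'b::banach) \<Rightarrow> real \<Rightarrow> 'b \<Rightarrow>\<^sub>L 'b" where
  "extrapolated_semigroup D A J = (SOME S. C0_semigroup S \<and>
     (\<forall>t\<ge>0. \<forall>x. blinfun_apply (S t) (J x) = J (blinfun_apply (semigroup_of D A t) x)))"

text \<open>\<open>A\<^sub>-\<^sub>1\<close>, whose domain \<open>gen_dom (extrapolated_semigroup D A J)\<close> is \<open>range J\<close>, that is, \<open>X\<close>.\<close>

definition extrapolated_op ::
    "'a::real_normed_vector set \<Rightarrow> ('a \<Rightarrow> 'a) \<Rightarrow> ('a \<Rightarrow> 'b::banach) \<Rightarrow> 'b \<Rightarrow> 'b" where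
  "extrapolated_op D A J = gen_op (extrapolated_semigroup D A J)"

definition extrapolated_cone :: "('a::banach_lattice \<Rightarrow> 'b::banach) \<Rightarrow> 'b set" where
  "extrapolated_cone J = closure (J ` {0..})"

text \<open>The part in \<open>X\<close> of an operator \<open>K\<close> from \<open>X\<close> to \<open>X\<^sub>-\<^sub>1\<close>.\<close>

definition part_dom :: "('a \<Rightarrow> 'b) \<Rightarrow> ('a \<Rightarrow> 'b) \<Rightarrow> 'a set" where
  "part_dom J K = {x. K x \<in> range J}"

definition part_op :: "('a \<Rightarrow> 'b) \<Rightarrow> ('a \<Rightarrow> 'b) \<Rightarrow> 'a \<Rightarrow> 'a" where
  "part_op J K x = inv J (K x)"

end

theory Submission
  imports Defs
begin

text \<open>Write \<open>R(s)\<close> for \<open>R(s,A)\<close> and let \<open>c \<parallel>x\<parallel> \<le> \<parallel>R(r) x\<parallel>\<close> on the positive cone. For \<open>s > r\<close> the resolvent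
  identity gives \<open>(s - r) R(s) R(r) \<le> R(r)\<close>, so \<open>(s - r) R(s)\<close> is a contraction for the equivalent
  norm \<open>\<parallel>R(r)\<bar>x\<bar>\<parallel>\<close>, and Hille--Yosida yields a positive semigroup. The same inequality bounds
  \<open>R(s,A\<^sub>-\<^sub>1)\<close> by a constant times \<open>1 / (s - r)\<close> on the cone of \<open>X\<^sub>-\<^sub>1\<close>; hence \<open>R(s,A\<^sub>-\<^sub>1) B\<close> is positive of norm
  at most \<open>1/2\<close> for large \<open>s\<close>, and by the Neumann series the part of \<open>A\<^sub>-\<^sub>1 + B\<close> in \<open>X\<close> has a
  resolvent dominating \<open>R(s)\<close>. It therefore satisfies the same hypotheses as \<open>A\<close>.

  The growth bound is at most any real \<open>q\<close> above the spectral bound: positivity and the lower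
  estimate propagate down to \<open>R(q)\<close>, and \<open>exp (- q t) S(t) R(q) \<le> R(q)\<close>. The converse inequality
  is general: if \<open>\<parallel>exp (- \<mu> t) S(t)\<parallel> < 1\<close>, then \<open>\<integral>\<^sub>0\<^sup>t exp (- \<mu> s) S(s) ds\<close> composed with
  \<open>(1 - exp (- \<mu> t) S(t))\<^sup>-\<^sup>1\<close> inverts \<open>\<mu> - A\<close>.\<close>

section \<open>Positive operators and resolvents\<close>

text \<open>The lower estimate is what allows a resolvent to be cancelled. If \<open>R\<close> is a
  positive resolvent, \<open>0 \<le> u\<close> and \<open>R u \<le> R v\<close>, then monotonicity
  of the norm gives \<open>c * norm u \<le> norm (R u) \<le> norm (R v)\<close>. The semigroup
  bound, the smallness of the perturbation and the growth bound all rest on this device; the order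
  inequality is read off from the resolvent identity or from the sign of an integral. Hille--Yosida
  is proved with implicit Euler products in place of exponentials of Yosida approximants. Every
  factor is a multiple of a resolvent, so contractivity and closed invariant sets such as the cone
  pass directly to the limit. Order arguments take place on the real space, whereas
  \<open>resolvent_set\<close> speaks of the complexification. For real points a component of the
  complex inverse is extracted; for the comparison of the spectral bound with the growth bound an
  inverse is built on pairs.\<close>

lemma norm_abs_lattice [simp]: "norm \<bar>x\<bar> = norm (x::'a::banach_lattice)"
  by (intro antisym norm_mono_abs) auto

lemma norm_mono_nonneg:
  fixes x y :: "'a::banach_lattice"
  assumes "0 \<le> x" "x \<le> y"
  shows "norm x \<le> norm y"
  using assms by (intro norm_mono_abs) (simp add: abs_of_nonneg)

text \<open>Since \<open>f n\<close> is nonnegative, the negative part \<open>sup (- l) 0\<close> of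
  the limit is at most \<open>\<bar>f n - l\<bar>\<close>, so its norm is bounded by a null
  sequence.\<close>

lemma closed_nonneg_cone: "closed {0::'a::banach_lattice..}"
  unfolding closed_sequential_limits
proof (intro allI impI, elim conjE)
  fix f :: "nat \<Rightarrow> 'a" and l
  assume f: "\<forall>n. f n \<in> {0..}" and l: "f \<longlonglongrightarrow> l"
  have "norm (sup (- l) 0) \<le> norm (f n - l)" for n
  proof (rule norm_mono_abs)
    have "0 \<le> f n" using f by simp
    then have "- l \<le> f n - l" by simp
    also have "\<dots> \<le> \<bar>f n - l\<bar>" by (rule abs_ge_self)
    finally have "sup (- l) 0 \<le> \<bar>f n - l\<bar>" by simp
    then show "\<bar>sup (- l) 0\<bar> \<le> \<bar>f n - l\<bar>" by (simp add: abs_of_nonneg)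
  qed
  moreover have "(\<lambda>n. norm (f n - l)) \<longlonglongrightarrow> 0"
    using l by (simp add: LIM_zero tendsto_norm_zero)
  ultimately have "norm (sup (- l) 0) \<le> 0"
    by (intro LIMSEQ_le_const) auto
  then have "sup (- l) 0 = 0" by simp
  then have "- l \<le> 0" by (metis sup_ge1)
  then show "l \<in> {0..}" by simp
qed

lemma nonneg_limit:
  fixes l :: "'a::banach_lattice"
  assumes "f \<longlonglongrightarrow> l" "\<And>n::nat. 0 \<le> f n"
  shows "0 \<le> l"
  using closed_sequentially[OF closed_nonneg_cone, of f l] assms by auto

text \<open>Monotonicity of scaling gives \<open>\<le>\<close> for every scalar and every vector;
  \<open>\<ge>\<close> is the same inequality for the scalar \<open>inverse r\<close> and the vector
  \<open>r *\<^sub>R x\<close>.\<close>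

lemma abs_scaleR_lattice: "\<bar>r *\<^sub>R x\<bar> = \<bar>r\<bar> *\<^sub>R \<bar>x :: 'a::banach_lattice\<bar>"
proof (rule antisym)
  have le: "\<bar>a *\<^sub>R z\<bar> \<le> \<bar>a\<bar> *\<^sub>R \<bar>z\<bar>" for a and z :: 'a
  proof (cases "0 \<le> a")
    case True
    then show ?thesis
      using scaleR_left_mono[OF abs_ge_self[of z], of a] scaleR_left_mono[OF abs_ge_minus_self[of z], of a]
      by (intro abs_leI) simp_all
  next
    case False
    then show ?thesis
      using scaleR_left_mono[OF abs_ge_self[of z], of "- a"]
        scaleR_left_mono[OF abs_ge_minus_self[of z], of "- a"]
      by (intro abs_leI) simp_all
  qed
  show "\<bar>r *\<^sub>R x\<bar> \<le> \<bar>r\<bar> *\<^sub>R \<bar>x\<bar>" by (rule le)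
  show "\<bar>r\<bar> *\<^sub>R \<bar>x\<bar> \<le> \<bar>r *\<^sub>R x\<bar>"
  proof (cases "r = 0")
    case False
    have "\<bar>r\<bar> *\<^sub>R \<bar>x\<bar> = \<bar>r\<bar> *\<^sub>R \<bar>inverse r *\<^sub>R (r *\<^sub>R x)\<bar>" using False by simp
    also have "\<dots> \<le> \<bar>r\<bar> *\<^sub>R (\<bar>inverse r\<bar> *\<^sub>R \<bar>r *\<^sub>R x\<bar>)"
      by (intro scaleR_left_mono le) simp
    also have "\<dots> = \<bar>r *\<^sub>R x\<bar>" using False by (simp add: abs_inverse)
    finally show ?thesis .
  qed simp
qed

lemma positive_linear_mono:
  fixes f :: "'a::banach_lattice \<Rightarrow> 'b::banach_lattice"
  assumes "linear f" "\<And>x. 0 \<le> x \<Longrightarrow> 0 \<le> f x" "x \<le> y"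
  shows "f x \<le> f y"
  using assms(2)[of "y - x"] assms(3) by (simp add: linear_diff[OF assms(1)])

lemma positive_linear_abs_le:
  fixes f :: "'a::banach_lattice \<Rightarrow> 'b::banach_lattice"
  assumes "linear f" "\<And>x. 0 \<le> x \<Longrightarrow> 0 \<le> f x"
  shows "\<bar>f x\<bar> \<le> f \<bar>x\<bar>"
proof (rule abs_leI)
  show "f x \<le> f \<bar>x\<bar>"
    by (rule positive_linear_mono[OF assms]) (auto simp: abs_ge_self)
  have "f (- x) \<le> f \<bar>x\<bar>"
    by (rule positive_linear_mono[OF assms]) (auto simp: abs_ge_minus_self)
  then show "- f x \<le> f \<bar>x\<bar>"
    by (simp add: linear_neg[OF assms(1)])
qed

text \<open>Order arguments yield norm estimates on the cone only. They extend to all vectors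
  because \<open>\<bar>f x\<bar> \<le> f \<bar>x\<bar>\<close> and \<open>\<bar>x\<bar>\<close> has
  the norm of \<open>x\<close>.\<close>

lemma positive_linear_norm_le:
  fixes f :: "'a::banach_lattice \<Rightarrow> 'b::banach_lattice"
  assumes "linear f" "\<And>x. 0 \<le> x \<Longrightarrow> 0 \<le> f x"
    and "\<And>x. 0 \<le> x \<Longrightarrow> norm (f x) \<le> C * norm x"
  shows "norm (f x) \<le> C * norm x"
proof -
  have "norm (f x) \<le> norm (f \<bar>x\<bar>)"
    using positive_linear_abs_le[OF assms(1,2), of x] assms(2)[of "\<bar>x\<bar>"]
    by (intro norm_mono_abs) (simp add: abs_of_nonneg)
  also have "\<dots> \<le> C * norm \<bar>x\<bar>" by (rule assms(3)) simp
  finally show ?thesis by simp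
qed

section \<open>Neumann series and their positivity\<close>

lemma funpow_linear:
  fixes f :: "'a::real_vector \<Rightarrow> 'a"
  shows "linear f \<Longrightarrow> linear (f ^^ n)"
  by (induction n) (auto simp: linear_iff)

text \<open>Besides the inverse \<open>N\<close> of \<open>I - T\<close> the series itself is handed
  out, because positivity of \<open>N\<close> is read off from its terms. The bound on
  \<open>N\<close> comes from \<open>N x = x + T (N x)\<close>, which gives
  \<open>(1 - q) * norm (N x) \<le> norm x\<close>.\<close>

lemma Neumann_series:
  fixes T :: "'a::banach \<Rightarrow> 'a"
  assumes T: "linear T" and q: "0 \<le> q" "q < 1" and Tq: "\<And>x. norm (T x) \<le> q * norm x"
  obtains N where "bounded_linear N" "\<And>x. N x - T (N x) = x" "\<And>x. N (x - T x) = x"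
    "\<And>x. (\<lambda>k. (T ^^ k) x) sums N x"
proof -
  define N where "N x = (\<Sum>k. (T ^^ k) x)" for x
  have blT: "bounded_linear T"
    using T Tq by (intro bounded_linear_intro[of _ q]) (auto simp: linear_add linear_scale mult.commute)
  have pow: "norm ((T ^^ k) x) \<le> q ^ k * norm x" for k x
  proof (induction k)
    case (Suc k)
    have "norm ((T ^^ Suc k) x) \<le> q * norm ((T ^^ k) x)" using Tq by simp
    also have "\<dots> \<le> q * (q ^ k * norm x)" by (rule mult_left_mono[OF Suc q(1)])
    finally show ?case by (simp add: mult.assoc)
  qed simp
  have geo: "summable (\<lambda>k. q ^ k * norm x)" for x
    using q by (intro summable_mult2 summable_geometric) auto
  have sm: "summable (\<lambda>k. (T ^^ k) x)" for x
    by (rule summable_comparison_test'[OF geo[of x], of 0]) (use pow in auto)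
  have sums: "(\<lambda>k. (T ^^ k) x) sums N x" for x
    unfolding N_def by (rule summable_sums[OF sm])
  have lin: "linear (T ^^ k)" for k by (rule funpow_linear[OF T])
  have add: "N (x + y) = N x + N y" for x y
    using sums_add[OF sums[of x] sums[of y]] sums[of "x + y"]
    by (simp add: linear_add[OF lin] sums_unique2)
  have scale: "N (r *\<^sub>R x) = r *\<^sub>R N x" for r x
    using sums_scaleR_right[OF sums[of x], of r] sums[of "r *\<^sub>R x"]
    by (simp add: linear_scale[OF lin] sums_unique2)
  have TN: "T (N x) = N (T x)" for x
  proof -
    have "(\<lambda>k. T ((T ^^ k) x)) sums T (N x)"
      by (rule bounded_linear.sums[OF blT sums])
    moreover have "(\<lambda>k. T ((T ^^ k) x)) = (\<lambda>k. (T ^^ k) (T x))"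
      by (simp add: funpow_swap1)
    ultimately show ?thesis using sums[of "T x"] by (simp add: sums_unique2)
  qed
  have eq: "N x - T (N x) = x" for x
  proof -
    have "(\<lambda>k. (T ^^ Suc k) x) sums (N x - (T ^^ 0) x)"
      using sums[of x] by (subst sums_Suc_iff) simp
    moreover have "(\<lambda>k. (T ^^ Suc k) x) sums T (N x)"
      using bounded_linear.sums[OF blT sums[of x]] by simp
    ultimately have "T (N x) = N x - x" by (simp add: sums_unique2)
    then show ?thesis by simp
  qed
  have bd: "norm (N x) \<le> norm x * (1 / (1 - q))" for x
  proof -
    have "norm (N x) \<le> norm (N x - T (N x)) + norm (T (N x))"
      using norm_triangle_ineq[of "N x - T (N x)" "T (N x)"] by simp
    then have "norm (N x) \<le> norm x + norm (T (N x))"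
      by (simp only: eq)
    also have "\<dots> \<le> norm x + q * norm (N x)" using Tq[of "N x"] by simp
    finally show ?thesis using q by (simp add: field_simps)
  qed
  have N: "bounded_linear N" by (rule bounded_linear_intro[OF add scale bd])
  have "N (x - T x) = x" for x
    using eq[of x] TN[of x] by (simp add: linear_diff[OF bounded_linear.linear[OF N]])
  with N eq sums show ?thesis by (intro that) auto
qed

lemma Neumann_nonneg:
  fixes T :: "'a::banach_lattice \<Rightarrow> 'a"
  assumes "\<And>x. 0 \<le> x \<Longrightarrow> 0 \<le> T x" "(\<lambda>k. (T ^^ k) x) sums y" "0 \<le> x"
  shows "0 \<le> y"
proof -
  have "0 \<le> (T ^^ k) x" for k
    by (induction k) (use assms in auto)
  then show ?thesis
    by (intro nonneg_limit[OF assms(2)[unfolded sums_def]] sum_nonneg)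
qed

text \<open>The notion of a real point of the resolvent set expressed on the real space itself,
  where the order lives, and not on the complexification.\<close>

definition regular :: "'a::real_normed_vector set \<Rightarrow> ('a \<Rightarrow> 'a) \<Rightarrow> real \<Rightarrow> bool" where
  "regular D A r \<longleftrightarrow> bij_betw (\<lambda>x. r *\<^sub>R x - A x) D UNIV \<and> bounded_linear (resolvent D A r)"

lemma resolvent_in_dom: "regular D A r \<Longrightarrow> resolvent D A r x \<in> D"
  unfolding regular_def resolvent_def by (metis UNIV_I bij_betw_imp_surj_on inv_into_into)

lemma resolvent_right: "regular D A r \<Longrightarrow> r *\<^sub>R resolvent D A r x - A (resolvent D A r x) = x"
  unfolding regular_def resolvent_def
  using bij_betw_inv_into_right[of "\<lambda>x. r *\<^sub>R x - A x" D UNIV x] by simp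

lemma op_resolvent: "regular D A r \<Longrightarrow> A (resolvent D A r x) = r *\<^sub>R resolvent D A r x - x"
  using resolvent_right[of D A r x] by (simp add: algebra_simps)

lemma resolvent_left: "regular D A r \<Longrightarrow> x \<in> D \<Longrightarrow> resolvent D A r (r *\<^sub>R x - A x) = x"
  unfolding regular_def resolvent_def
  using bij_betw_inv_into_left[of "\<lambda>x. r *\<^sub>R x - A x" D UNIV x] by simp

lemma bounded_linear_resolvent: "regular D A r \<Longrightarrow> bounded_linear (resolvent D A r)"
  by (simp add: regular_def)

lemma linear_resolvent: "regular D A r \<Longrightarrow> linear (resolvent D A r)"
  by (simp add: bounded_linear.linear bounded_linear_resolvent)

lemma regularI:
  assumes "\<And>x. N x \<in> D" "\<And>x. r *\<^sub>R N x - A (N x) = x"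
    "\<And>x. x \<in> D \<Longrightarrow> N (r *\<^sub>R x - A x) = x" "bounded_linear N"
  shows "regular D A r" "resolvent D A r = N"
proof -
  have b: "bij_betw (\<lambda>x. r *\<^sub>R x - A x) D UNIV"
    by (rule bij_betw_byWitness[where f' = N]) (use assms in auto)
  show eq: "resolvent D A r = N"
  proof
    fix y
    have "inv_into D (\<lambda>x. r *\<^sub>R x - A x) (r *\<^sub>R N y - A (N y)) = N y"
      by (rule inv_into_f_f[OF bij_betw_imp_inj_on[OF b] assms(1)])
    then show "resolvent D A r y = N y"
      unfolding resolvent_def assms(2) .
  qed
  show "regular D A r" unfolding regular_def using b eq assms(4) by simp
qed

lemma resolvent_identity:
  assumes "regular D A r" "regular D A s"
  shows "resolvent D A r x - resolvent D A s x = (s - r) *\<^sub>R resolvent D A r (resolvent D A s x)"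
proof -
  let ?u = "resolvent D A s x"
  have "r *\<^sub>R ?u - A ?u = x - (s - r) *\<^sub>R ?u"
    by (simp add: op_resolvent[OF assms(2)] algebra_simps)
  then have "?u = resolvent D A r (x - (s - r) *\<^sub>R ?u)"
    using resolvent_left[OF assms(1) resolvent_in_dom[OF assms(2)]] by metis
  then show ?thesis
    by (simp add: linear_diff[OF linear_resolvent[OF assms(1)]]
        linear_scale[OF linear_resolvent[OF assms(1)]])
      (metis diff_diff_eq2 add_diff_cancel_left')
qed

text \<open>At a real point \<open>cscale\<close> acts on both components separately, so the
  complexified map is a product of two copies of \<open>r - A\<close>. Its inverse, restricted to
  pairs \<open>(x, 0)\<close> and followed by \<open>fst\<close>, inverts
  \<open>r - A\<close>.\<close>

lemma resolvent_set_imp_regular: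
  fixes D :: "'a::real_normed_vector set"
  assumes "complex_of_real r \<in> resolvent_set D A"
  shows "regular D A r"
proof -
  let ?f = "\<lambda>x. r *\<^sub>R x - A x"
  let ?g = "\<lambda>z. cscale (complex_of_real r) z - map_prod A A z"
  have g: "?g = map_prod ?f ?f"
    by (auto simp: cscale_def fun_eq_iff)
  have b: "bij_betw (map_prod ?f ?f) (D \<times> D) UNIV"
    and l: "bounded_linear (inv_into (D \<times> D) (map_prod ?f ?f))"
    using assms unfolding resolvent_set_def mem_Collect_eq g by blast+
  define h where "h = inv_into (D \<times> D) (map_prod ?f ?f)"
  define N where "N x = fst (h (x, 0))" for x
  have hD: "h z \<in> D \<times> D" for z
    unfolding h_def by (rule inv_into_into) (simp only: bij_betw_imp_surj_on[OF b] UNIV_I)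
  have hr: "map_prod ?f ?f (h z) = z" for z
    unfolding h_def using bij_betw_inv_into_right[OF b] by simp
  have hl: "h (map_prod ?f ?f z) = z" if "z \<in> D \<times> D" for z
    unfolding h_def using bij_betw_inv_into_left[OF b] that by simp
  have lh: "bounded_linear h" using l by (simp add: h_def)
  show ?thesis
  proof (rule regularI(1)[of N])
    show "N x \<in> D" for x using hD[of "(x, 0)"] by (auto simp: N_def mem_Times_iff)
    show "?f (N x) = x" for x using hr[of "(x, 0)"]
      unfolding N_def by (cases "h (x, 0)") simp
    show "bounded_linear N"
      unfolding N_def
      by (rule bounded_linear_compose[OF bounded_linear_fst
            bounded_linear_compose[OF lh bounded_linear_Pair[OF bounded_linear_ident bounded_linear_zero]]])
    show "N (?f x) = x" if "x \<in> D" for x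
    proof -
      \<comment> \<open>\<open>A\<close> is an arbitrary function here, so the role of
        \<open>0\<close> in the second component is taken by a point \<open>d\<close> of
        \<open>D\<close> that is mapped to \<open>0\<close>.\<close>
      obtain d where d: "d \<in> D" "?f d = 0"
        using hr[of "(0,0)"] hD[of "(0,0)"] by (cases "h (0, 0)") auto
      have "h (?f x, ?f d) = (x, d)" using hl[of "(x, d)"] that d(1) by simp
      then show ?thesis using d by (simp add: N_def)
    qed
  qed
qed

section \<open>Generation of contraction semigroups\<close>

text \<open>With step size \<open>1 / 2 ^ k\<close>, the number of whole steps in
  \<open>s + t\<close> exceeds the sum of those in \<open>s\<close> and in \<open>t\<close> by at
  most one. This surplus step is the rounding error in the refinement estimate and in the semigroup
  law.\<close>

lemma nat_floor_add_cases:
  fixes u v :: real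
  assumes "0 \<le> u" "0 \<le> v"
  shows "nat \<lfloor>u + v\<rfloor> = nat \<lfloor>u\<rfloor> + nat \<lfloor>v\<rfloor> \<or> nat \<lfloor>u + v\<rfloor> = Suc (nat \<lfloor>u\<rfloor> + nat \<lfloor>v\<rfloor>)"
proof -
  have "\<lfloor>u + v\<rfloor> = \<lfloor>u\<rfloor> + \<lfloor>v\<rfloor> \<or> \<lfloor>u + v\<rfloor> = \<lfloor>u\<rfloor> + \<lfloor>v\<rfloor> + 1"
    by linarith
  moreover have "0 \<le> \<lfloor>u\<rfloor>" "0 \<le> \<lfloor>v\<rfloor>" using assms by auto
  ultimately show ?thesis by linarith
qed

text \<open>Hille--Yosida for contractions in an equivalent norm \<open>p\<close>, with the growth
  rate normalised to zero. Estimates are made in \<open>p\<close>, while completeness and topology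
  are those of the type; \<open>p_lower\<close> and \<open>p_upper\<close> translate between the
  two.\<close>

locale dissipative_operator =
  fixes D :: "'a::banach set" and A :: "'a \<Rightarrow> 'a" and p :: "'a \<Rightarrow> real" and m M :: real
  assumes lin: "linear_operator D A"
    and dense: "closure D = UNIV"
    and p_add: "p (x + y) \<le> p x + p y"
    and p_scale: "p (r *\<^sub>R x) = \<bar>r\<bar> * p x"
    and p_lower: "m * norm x \<le> p x"
    and p_upper: "p x \<le> M * norm x"
    and m_pos: "0 < m"
    and reg: "0 < r \<Longrightarrow> regular D A r"
    and p_resolvent: "0 < r \<Longrightarrow> r * p (resolvent D A r x) \<le> p x"
begin

lemma p_nonneg: "0 \<le> p x"
  using p_lower[of x] m_pos by (meson norm_ge_zero mult_nonneg_nonneg less_imp_le order_trans)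

lemma p_minus: "p (- x) = p x"
  using p_scale[of "-1" x] by simp

lemma p_zero: "p 0 = 0"
  using p_scale[of 0 0] by simp

lemma p_diff: "p (x - y) \<le> p x + p y"
  using p_add[of x "- y"] by (simp add: p_minus)

lemma p_commute: "p (x - y) = p (y - x)"
  using p_minus[of "x - y"] by simp

lemma p_triangle: "p (x - z) \<le> p (x - y) + p (y - z)"
  using p_add[of "x - y" "y - z"] by simp

lemma p_tendsto:
  assumes "(f \<longlongrightarrow> l) F"
  shows "((\<lambda>x. p (f x)) \<longlongrightarrow> p l) F"
proof (rule metric_tendsto_imp_tendsto)
  show "((\<lambda>x. M * norm (f x - l)) \<longlongrightarrow> M * 0) F"
    using assms by (intro tendsto_intros) (simp add: LIM_zero tendsto_norm_zero)
  show "\<forall>\<^sub>F x in F. dist (p (f x)) (p l) \<le> dist (M * norm (f x - l)) (M * 0)"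
  proof (intro always_eventually allI)
    fix x
    have "\<bar>p (f x) - p l\<bar> \<le> p (f x - l)"
      using p_triangle[of "f x" 0 l] p_triangle[of l 0 "f x"] p_commute[of l "f x"] by simp
    also have "\<dots> \<le> M * norm (f x - l)" by (rule p_upper)
    finally show "dist (p (f x)) (p l) \<le> dist (M * norm (f x - l)) (M * 0)"
      by (simp add: dist_real_def)
  qed
qed

lemma p_limit_le:
  assumes "f \<longlonglongrightarrow> l" "\<And>k::nat. p (f k) \<le> c"
  shows "p l \<le> c"
  by (rule LIMSEQ_le_const2[OF p_tendsto[OF assms(1)]]) (use assms(2) in auto)

lemma tendstoI_p:
  assumes "\<And>e. 0 < e \<Longrightarrow> \<forall>\<^sub>F t in F. p (f t - l) < e"
  shows "(f \<longlongrightarrow> l) F"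
proof (rule tendstoI)
  fix e :: real assume "0 < e"
  then have "\<forall>\<^sub>F t in F. p (f t - l) < m * e" using m_pos by (intro assms) simp
  then show "\<forall>\<^sub>F t in F. dist (f t) l < e"
  proof (rule eventually_mono)
    fix t assume "p (f t - l) < m * e"
    then have "m * norm (f t - l) < m * e" using p_lower[of "f t - l"] by linarith
    then show "dist (f t) l < e" using m_pos by (simp add: dist_norm)
  qed
qed

lemma A_diff: "x \<in> D \<Longrightarrow> y \<in> D \<Longrightarrow> A (x - y) = A x - A y"
proof -
  assume "x \<in> D" "y \<in> D"
  then have "- y \<in> D" "A (- y) = - A y"
    using lin unfolding linear_operator_def by (auto simp: subspace_neg) (metis scaleR_minus1_left)
  then show ?thesis
    using lin \<open>x \<in> D\<close> unfolding linear_operator_def by (metis add_uminus_conv_diff)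
qed

lemma A_scale: "x \<in> D \<Longrightarrow> A (r *\<^sub>R x) = r *\<^sub>R A x"
  and D_scale: "x \<in> D \<Longrightarrow> r *\<^sub>R x \<in> D"
  and D_diff: "x \<in> D \<Longrightarrow> y \<in> D \<Longrightarrow> x - y \<in> D"
  using lin unfolding linear_operator_def by (auto simp: subspace_scale subspace_diff)

text \<open>This is \<open>(I - h A)^-1\<close>, one implicit Euler step of length \<open>h\<close>
  for \<open>u' = A u\<close>.\<close>

definition F :: "real \<Rightarrow> 'a \<Rightarrow> 'a" where
  "F h x = (1 / h) *\<^sub>R resolvent D A (1 / h) x"

section \<open>Powers of a single Euler step\<close>

context
  fixes h :: real
  assumes h: "0 < h"
begin

lemma F_reg: "regular D A (1 / h)"
  using h by (intro reg) simp

lemma F_dom: "F h x \<in> D"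
  unfolding F_def by (intro D_scale resolvent_in_dom F_reg)

lemma F_linear: "linear (F h)"
  unfolding F_def[abs_def]
  by (intro linear_compose_scale_right linear_resolvent F_reg)

lemma F_step: "F h x - x = h *\<^sub>R A (F h x)"
  using h unfolding F_def
  by (simp add: A_scale resolvent_in_dom[OF F_reg] op_resolvent[OF F_reg])

lemma F_left: "y \<in> D \<Longrightarrow> F h (y - h *\<^sub>R A y) = y"
proof -
  assume y: "y \<in> D"
  have "F h (y - h *\<^sub>R A y) = resolvent D A (1 / h) ((1 / h) *\<^sub>R (y - h *\<^sub>R A y))"
    unfolding F_def by (simp only: linear_scale[OF linear_resolvent[OF F_reg]])
  also have "(1 / h) *\<^sub>R (y - h *\<^sub>R A y) = (1 / h) *\<^sub>R y - A y"
    using h by (simp add: scaleR_diff_right)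
  finally show ?thesis using resolvent_left[OF F_reg y] by simp
qed

lemma F_contraction: "p (F h x) \<le> p x"
  using p_resolvent[of "1 / h" x] h by (simp add: F_def p_scale)

lemma A_F: "y \<in> D \<Longrightarrow> A (F h y) = F h (A y)"
proof -
  assume y: "y \<in> D"
  have "F h y - h *\<^sub>R F h (A y) = y"
    using F_left[OF y] by (simp add: linear_diff[OF F_linear] linear_scale[OF F_linear])
  then have "h *\<^sub>R F h (A y) = h *\<^sub>R A (F h y)"
    using F_step[of y] by (simp add: algebra_simps)
  then show ?thesis using h by simp
qed

lemma F_diff_le: "y \<in> D \<Longrightarrow> p (F h y - y) \<le> h * p (A y)"
  using F_contraction[of "A y"] h by (simp add: F_step A_F p_scale)

lemma F_pow_linear: "linear (F h ^^ n)"
  by (rule funpow_linear[OF F_linear])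

lemma F_pow_contraction: "p ((F h ^^ n) x) \<le> p x"
proof (induction n)
  case (Suc n)
  then show ?case using F_contraction[of "(F h ^^ n) x"] by simp
qed simp

lemma F_pow_diff_le: "y \<in> D \<Longrightarrow> p ((F h ^^ n) y - y) \<le> n * h * p (A y)"
proof (induction n)
  case (Suc n)
  have "p ((F h ^^ Suc n) y - y) \<le> p (F h ((F h ^^ n) y - y)) + p (F h y - y)"
    using p_triangle[of "(F h ^^ Suc n) y" y "F h y"] by (simp add: linear_diff[OF F_linear])
  also have "\<dots> \<le> n * h * p (A y) + h * p (A y)"
    using F_contraction[of "(F h ^^ n) y - y"] Suc F_diff_le by (intro add_mono) auto
  finally show ?case by (simp add: algebra_simps)
qed (simp add: p_zero)

text \<open>Each increment of the Euler product is \<open>h\<close> times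
  \<open>(F h ^^ Suc n) (A y)\<close>, so the linearisation error accumulates the distances of these
  vectors from \<open>A y\<close>. As \<open>A y\<close> may lie outside \<open>D\<close>, it is
  replaced by a nearby \<open>z\<close> in \<open>D\<close>, at the price of
  \<open>2 * p (A y - z)\<close>. The bound depends on \<open>h\<close> only through the elapsed
  time \<open>n * h\<close> and therefore survives refinement.\<close>

lemma F_pow_derivative:
  assumes "y \<in> D" "z \<in> D"
  shows "p ((F h ^^ n) y - y - (n * h) *\<^sub>R A y) \<le> n * h * (2 * p (A y - z) + n * h * p (A z))"
proof (induction n)
  case (Suc n)
  let ?a = "p (A y - z)" and ?b = "p (A z)"
  have "(F h ^^ Suc n) y - (F h ^^ n) y = (F h ^^ n) (F h y - y)"
    by (simp add: linear_diff[OF F_pow_linear] funpow_swap1)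
  also have "\<dots> = h *\<^sub>R (F h ^^ Suc n) (A y)"
    by (simp add: F_step A_F assms linear_scale[OF F_pow_linear] funpow_swap1)
  finally have *: "(F h ^^ Suc n) y - y - (Suc n * h) *\<^sub>R A y
      = ((F h ^^ n) y - y - (n * h) *\<^sub>R A y) + h *\<^sub>R ((F h ^^ Suc n) (A y) - A y)"
    by (simp add: algebra_simps)
  have "p ((F h ^^ Suc n) (A y) - A y)
      \<le> p ((F h ^^ Suc n) (A y - z)) + p ((F h ^^ Suc n) z - z) + p (z - A y)"
    using p_triangle[of "(F h ^^ Suc n) (A y)" "A y" "(F h ^^ Suc n) z"]
      p_triangle[of "(F h ^^ Suc n) z" "A y" z]
    by (simp only: linear_diff[OF F_pow_linear])
  also have "\<dots> \<le> ?a + Suc n * h * ?b + ?a"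
    using F_pow_contraction[of "Suc n" "A y - z"] F_pow_diff_le[OF assms(2), of "Suc n"]
      p_commute[of z "A y"] by linarith
  finally have "h * p ((F h ^^ Suc n) (A y) - A y) \<le> h * (2 * ?a + Suc n * h * ?b)"
    using h by (intro mult_left_mono) auto
  moreover have "p (h *\<^sub>R ((F h ^^ Suc n) (A y) - A y)) = h * p ((F h ^^ Suc n) (A y) - A y)"
    using h by (simp only: p_scale abs_of_pos)
  ultimately have "p ((F h ^^ Suc n) y - y - (Suc n * h) *\<^sub>R A y)
      \<le> n * h * (2 * ?a + n * h * ?b) + h * (2 * ?a + Suc n * h * ?b)"
    unfolding * using p_add[of "(F h ^^ n) y - y - (n * h) *\<^sub>R A y"
        "h *\<^sub>R ((F h ^^ Suc n) (A y) - A y)"] Suc by linarith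
  also have "\<dots> \<le> Suc n * h * (2 * ?a + Suc n * h * ?b)"
  proof -
    have "n * h * (2 * ?a + n * h * ?b) \<le> n * h * (2 * ?a + Suc n * h * ?b)"
      using h p_nonneg by (intro mult_left_mono add_mono mult_right_mono) auto
    then show ?thesis by (simp add: algebra_simps)
  qed
  finally show ?case .
qed (simp add: p_zero)

end

text \<open>\<open>F g (F h x)\<close> solves the implicit equation
  \<open>u - h *\<^sub>R A u = F g x\<close>, and \<open>F_left\<close> identifies its solution in
  \<open>D\<close> as \<open>F h (F g x)\<close>.\<close>

lemma F_commute: "0 < g \<Longrightarrow> 0 < h \<Longrightarrow> F g (F h x) = F h (F g x)"
proof -
  assume g: "0 < g" and h: "0 < h"
  let ?z = "F h x"
  have "F g ?z - h *\<^sub>R A (F g ?z) = F g (?z - h *\<^sub>R A ?z)"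
    using F_dom[OF h] by (simp add: linear_diff[OF F_linear[OF g]] linear_scale[OF F_linear[OF g]] A_F[OF g])
  also have "?z - h *\<^sub>R A ?z = x" using F_step[OF h, of x] by (simp add: algebra_simps)
  finally show ?thesis using F_left[OF h F_dom[OF g], of ?z] by simp
qed

text \<open>The second-order agreement of one implicit Euler step with two steps of half the size makes
  the dyadic refinements converge geometrically on \<open>D(A\<^sup>2)\<close>.\<close>

lemma F_halving:
  assumes h: "0 < h" and y: "y \<in> D" "A y \<in> D"
  shows "p (F h y - F (h / 2) (F (h / 2) y)) \<le> h\<^sup>2 / 4 * p (A (A y))"
proof -
  define g where "g = h / 2"
  have g: "0 < g" "h = 2 * g" using h by (auto simp: g_def)
  let ?y = "y - g *\<^sub>R A y"
  have yD: "?y \<in> D" using y by (intro D_diff D_scale)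
  have Ay: "A ?y = A y - g *\<^sub>R A (A y)" using y by (simp add: A_diff A_scale D_scale)
  have "F g (F g (?y - g *\<^sub>R A ?y)) = y"
    using F_left[OF g(1) yD] F_left[OF g(1) y(1)] by simp
  \<comment> \<open>The identity \<open>(I - g A)\<^sup>2 = (I - h A) + g\<^sup>2 A\<^sup>2\<close>
    for \<open>h = 2 * g\<close>. Applying \<open>F g\<close> twice and \<open>F h\<close> once
    leaves exactly the difference to be bounded, and \<open>g\<^sup>2\<close> is
    \<open>h\<^sup>2 / 4\<close>.\<close>
  also have "?y - g *\<^sub>R A ?y = (y - h *\<^sub>R A y) + g\<^sup>2 *\<^sub>R A (A y)"
    unfolding Ay g(2) by (simp add: algebra_simps power2_eq_square flip: scaleR_2)
  finally have "F g (F g (y - h *\<^sub>R A y)) + g\<^sup>2 *\<^sub>R F g (F g (A (A y))) = y"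
    by (simp add: linear_add[OF F_linear[OF g(1)]] linear_scale[OF F_linear[OF g(1)]])
  then have "F h y = F h (F g (F g (y - h *\<^sub>R A y))) + g\<^sup>2 *\<^sub>R F h (F g (F g (A (A y))))"
    by (simp add: linear_add[OF F_linear[OF h], symmetric] linear_scale[OF F_linear[OF h], symmetric])
  moreover have "F h (F g (F g (y - h *\<^sub>R A y))) = F g (F g y)"
    using F_left[OF h y(1)] by (simp add: F_commute[OF h g(1)])
  ultimately have "F h y - F g (F g y) = g\<^sup>2 *\<^sub>R F h (F g (F g (A (A y))))" by simp
  then have "p (F h y - F g (F g y)) = g\<^sup>2 * p (F h (F g (F g (A (A y)))))"
    by (simp add: p_scale)
  also have "\<dots> \<le> g\<^sup>2 * p (A (A y))"
    using F_contraction[OF h] F_contraction[OF g(1)] by (intro mult_left_mono) (meson order_trans, simp)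
  finally show ?thesis unfolding g_def by (simp add: power_divide)
qed

text \<open>Stability and consistency: commutation lets the new local error be carried along by
  \<open>F (h / 2) ^^ (2 * n)\<close> and the old global error by \<open>F h\<close>. Both are
  contractions, so the local errors just add up.\<close>

lemma F_pow_halving:
  assumes h: "0 < h" and y: "y \<in> D" "A y \<in> D"
  shows "p ((F h ^^ n) y - (F (h / 2) ^^ (2 * n)) y) \<le> n * (h\<^sup>2 / 4 * p (A (A y)))"
proof (induction n)
  case (Suc n)
  let ?G = "F (h / 2)"
  have h2: "0 < h / 2" using h by simp
  have comm: "F h ((?G ^^ k) x) = (?G ^^ k) (F h x)" for k x
    by (induction k) (simp_all add: F_commute[OF h h2])
  have "(?G ^^ (2 * Suc n)) y = (?G ^^ (2 * n)) (?G (?G y))"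
    by (simp add: funpow_swap1)
  then have *: "(F h ^^ Suc n) y - (?G ^^ (2 * Suc n)) y
      = F h ((F h ^^ n) y - (?G ^^ (2 * n)) y) + (?G ^^ (2 * n)) (F h y - ?G (?G y))"
    by (simp add: linear_diff[OF F_linear[OF h]] linear_diff[OF F_pow_linear[OF h2]] comm)
  have "p ((F h ^^ Suc n) y - (?G ^^ (2 * Suc n)) y)
      \<le> p ((F h ^^ n) y - (?G ^^ (2 * n)) y) + p (F h y - ?G (?G y))"
    unfolding *
    by (rule order_trans[OF p_add] add_mono F_contraction[OF h] F_pow_contraction[OF h2])+
  also have "\<dots> \<le> n * (h\<^sup>2 / 4 * p (A (A y))) + h\<^sup>2 / 4 * p (A (A y))"
    by (intro add_mono Suc F_halving h y)
  finally show ?case by (simp add: algebra_simps)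
qed (simp add: p_zero)

section \<open>Dyadic Euler products and their convergence\<close>

definition T :: "nat \<Rightarrow> real \<Rightarrow> 'a \<Rightarrow> 'a" where
  "T k t = F (1 / 2 ^ k) ^^ nat \<lfloor>2 ^ k * t\<rfloor>"

lemma T_linear: "linear (T k t)"
  unfolding T_def by (rule F_pow_linear) simp

lemma T_contraction: "p (T k t x) \<le> p x"
  unfolding T_def by (rule F_pow_contraction) simp

lemma T_zero: "T k 0 x = x"
  by (simp add: T_def)

lemma step_count_le: "0 \<le> t \<Longrightarrow> nat \<lfloor>2 ^ k * t\<rfloor> * (1 / 2 ^ k) \<le> t"
proof -
  assume "0 \<le> t"
  then have "real (nat \<lfloor>2 ^ k * t\<rfloor>) \<le> 2 ^ k * t" by simp
  then show ?thesis by (simp add: field_simps)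
qed

lemma T_diff_le:
  assumes "0 \<le> t" "y \<in> D"
  shows "p (T k t y - y) \<le> t * p (A y)"
proof -
  have "p (T k t y - y) \<le> nat \<lfloor>2 ^ k * t\<rfloor> * (1 / 2 ^ k) * p (A y)"
    unfolding T_def by (rule F_pow_diff_le) (use assms in auto)
  also have "\<dots> \<le> t * p (A y)"
    by (intro mult_right_mono step_count_le assms p_nonneg)
  finally show ?thesis .
qed

text \<open>Halving the steps costs \<open>n * h \<le> t\<close> times
  \<open>h / 4 * p (A (A y))\<close>. Rounding at the finer level may add one half step, which costs
  at most \<open>h / 2 * p (A y)\<close>. Both are proportional to \<open>h = 1 / 2 ^ k\<close>,
  hence summable in \<open>k\<close>.\<close>

lemma T_refine:
  assumes "0 \<le> t" "y \<in> D" "A y \<in> D"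
  shows "p (T (Suc k) t y - T k t y) \<le> (t / 4 * p (A (A y)) + p (A y)) * (1 / 2) ^ k"
proof -
  define h :: real where "h = 1 / 2 ^ k"
  define n where "n = nat \<lfloor>2 ^ k * t\<rfloor>"
  have h: "0 < h" "0 < h / 2" by (auto simp: h_def)
  have Tk: "T k t y = (F h ^^ n) y" by (simp add: T_def h_def n_def)
  have hS: "1 / 2 ^ Suc k = h / 2" by (simp add: h_def)
  have e: "2 ^ Suc k * t = 2 ^ k * t + 2 ^ k * t" by simp
  have "0 \<le> 2 ^ k * t" using assms(1) by simp
  then have "nat \<lfloor>2 ^ Suc k * t\<rfloor> = 2 * n \<or> nat \<lfloor>2 ^ Suc k * t\<rfloor> = Suc (2 * n)"
    unfolding e n_def mult_2 by (intro nat_floor_add_cases)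
  then have "T (Suc k) t y = (F (h / 2) ^^ (2 * n)) y \<or>
      T (Suc k) t y = (F (h / 2) ^^ (2 * n)) (F (h / 2) y)"
    unfolding T_def hS by (auto simp: funpow_swap1)
  moreover have "p ((F (h / 2) ^^ (2 * n)) (F (h / 2) y) - (F (h / 2) ^^ (2 * n)) y) \<le> h / 2 * p (A y)"
    using order_trans[OF F_pow_contraction[OF h(2)] F_diff_le[OF h(2) assms(2)]]
    by (simp add: linear_diff[OF F_pow_linear[OF h(2)]])
  ultimately have "p (T (Suc k) t y - (F (h / 2) ^^ (2 * n)) y) \<le> h / 2 * p (A y)"
    using h p_nonneg[of "A y"] by (auto simp: p_zero)
  moreover have "p ((F (h / 2) ^^ (2 * n)) y - T k t y) \<le> (n * h) * (h / 4 * p (A (A y)))"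
    using F_pow_halving[OF h(1) assms(2,3), of n] unfolding Tk
    by (subst p_commute) (simp add: power2_eq_square algebra_simps)
  moreover have "(n * h) * (h / 4 * p (A (A y))) \<le> t * (h / 4 * p (A (A y)))"
    using step_count_le[OF assms(1), of k] h p_nonneg unfolding n_def h_def
    by (intro mult_right_mono) auto
  moreover have "h / 2 * p (A y) \<le> h * p (A y)"
    using h p_nonneg by (intro mult_right_mono) auto
  ultimately have "p (T (Suc k) t y - T k t y) \<le> h * p (A y) + t * (h / 4 * p (A (A y)))"
    using p_triangle[of "T (Suc k) t y" "T k t y" "(F (h / 2) ^^ (2 * n)) y"] by linarith
  also have "\<dots> = (t / 4 * p (A (A y)) + p (A y)) * (1 / 2) ^ k"
    by (simp add: h_def power_one_over algebra_simps)
  finally show ?thesis .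
qed

text \<open>After approximation by some \<open>z\<close> in \<open>D\<close>, one short Euler step
  smooths further: \<open>A (F h z) = F h (A z)\<close> lies in \<open>D\<close> again, and
  \<open>F h z\<close> is within \<open>h * p (A z)\<close> of \<open>z\<close>.\<close>

lemma domain_square_dense:
  assumes "0 < e"
  obtains y where "y \<in> D" "A y \<in> D" "p (x - y) < e"
proof -
  have M1: "0 < \<bar>M\<bar> + 1" by simp
  then have "0 < e / 2 / (\<bar>M\<bar> + 1)" using assms by (intro divide_pos_pos) auto
  moreover have "x \<in> closure D" by (simp add: dense)
  ultimately obtain z where z: "z \<in> D" "dist z x < e / 2 / (\<bar>M\<bar> + 1)"
    unfolding closure_approachable by blast
  have "p (x - z) \<le> (\<bar>M\<bar> + 1) * dist z x"
    using p_upper[of "x - z"] by (rule order_trans) (auto simp: dist_norm norm_minus_commute intro: mult_right_mono)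
  also have "\<dots> < e / 2"
    using z(2) by (simp only: pos_less_divide_eq[OF M1] mult.commute)
  finally have xz: "p (x - z) < e / 2" .
  define h where "h = e / 2 / (p (A z) + 1)"
  have h: "0 < h" using assms p_nonneg[of "A z"] by (simp add: h_def)
  have "p (z - F h z) \<le> h * p (A z)"
    using F_diff_le[OF h z(1)] by (simp add: p_commute)
  also have "\<dots> \<le> h * (p (A z) + 1)" using h by simp
  also have "\<dots> = e / 2"
    using p_nonneg[of "A z"] by (intro iffD1[OF nonzero_eq_divide_eq h_def]) simp
  finally have "p (x - F h z) < e"
    using xz p_triangle[of x "F h z" z] by simp
  moreover have "F h z \<in> D" "A (F h z) \<in> D"
    using F_dom[OF h] A_F[OF h z(1)] by auto
  ultimately show ?thesis by (intro that)
qed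

lemma T_convergent_core:
  assumes "0 \<le> t" "y \<in> D" "A y \<in> D"
  shows "convergent (\<lambda>k. T k t y)"
proof -
  let ?C = "(t / 4 * p (A (A y)) + p (A y)) / m"
  have "summable (\<lambda>k. T (Suc k) t y - T k t y)"
  proof (rule summable_comparison_test'[of "\<lambda>k. ?C * (1 / 2) ^ k" 0])
    show "summable (\<lambda>k. ?C * (1 / 2) ^ k)"
      by (intro summable_mult summable_geometric) simp
    fix k :: nat
    show "norm (T (Suc k) t y - T k t y) \<le> ?C * (1 / 2) ^ k"
      using order_trans[OF p_lower T_refine[OF assms, of k]] m_pos
      by (simp add: pos_le_divide_eq mult.commute)
  qed
  then have "convergent (\<lambda>n. \<Sum>k<n. T (Suc k) t y - T k t y)"
    by (simp add: summable_iff_convergent)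
  then have "convergent (\<lambda>n. T n t y - T 0 t y)"
    using sum_lessThan_telescope[of "\<lambda>n. T n t y"] by simp
  then have "convergent (\<lambda>n. (T n t y - T 0 t y) + T 0 t y)"
    by (intro convergent_add convergent_const)
  then show ?thesis by simp
qed

lemma T_convergent:
  assumes "0 \<le> t"
  shows "convergent (\<lambda>k. T k t x)"
proof (rule Cauchy_convergent, rule metric_CauchyI)
  fix e :: real assume e: "0 < e"
  obtain y where y: "y \<in> D" "A y \<in> D" "p (x - y) < m * e / 3"
    using domain_square_dense[of "m * e / 3" x] e m_pos by auto
  have "Cauchy (\<lambda>k. T k t y)"
    using T_convergent_core[OF assms y(1,2)] by (rule convergent_Cauchy)
  moreover have M1: "0 < \<bar>M\<bar> + 1" by simp
  then have "0 < m * e / 3 / (\<bar>M\<bar> + 1)" using e m_pos by (intro divide_pos_pos) auto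
  ultimately obtain N where N: "\<forall>a\<ge>N. \<forall>b\<ge>N. dist (T a t y) (T b t y) < m * e / 3 / (\<bar>M\<bar> + 1)"
    by (blast dest: metric_CauchyD)
  show "\<exists>N. \<forall>a\<ge>N. \<forall>b\<ge>N. dist (T a t x) (T b t x) < e"
  proof (intro exI[of _ N] allI impI)
    fix a b assume ab: "a \<ge> N" "b \<ge> N"
    have "p (T a t y - T b t y) \<le> (\<bar>M\<bar> + 1) * norm (T a t y - T b t y)"
      using p_upper by (rule order_trans) (auto intro: mult_right_mono)
    also have "\<dots> < m * e / 3"
      using N[rule_format, OF ab] by (simp only: dist_norm pos_less_divide_eq[OF M1] mult.commute)
    finally have 1: "p (T a t y - T b t y) < m * e / 3" .
    have 2: "p (T k t x - T k t y) < m * e / 3" for k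
      using order.strict_trans1[OF T_contraction y(3)] by (simp add: linear_diff[OF T_linear])
    have "p (T a t x - T b t x) < m * e"
      using p_triangle[of "T a t x" "T b t x" "T a t y"] p_triangle[of "T a t y" "T b t x" "T b t y"]
        1 2[of a] 2[of b] p_commute[of "T b t x" "T b t y"] by linarith
    then have "m * norm (T a t x - T b t x) < m * e"
      using p_lower by (rule order.strict_trans1[rotated])
    then show "dist (T a t x) (T b t x) < e"
      using m_pos by (simp add: dist_norm)
  qed
qed

text \<open>The \<open>max\<close> makes every \<open>S0 t\<close> linear and contractive, including the junk times \<open>t < 0\<close>.\<close>

definition S0 :: "real \<Rightarrow> 'a \<Rightarrow> 'a" where
  "S0 t x = lim (\<lambda>k. T k (max t 0) x)"

lemma S0_limit: "0 \<le> t \<Longrightarrow> (\<lambda>k. T k t x) \<longlonglongrightarrow> S0 t x"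
  unfolding S0_def using T_convergent[of t x] by (simp add: convergent_LIMSEQ_iff max_def)

lemma S0_limit': "(\<lambda>k. T k (max t 0) x) \<longlonglongrightarrow> S0 t x"
  unfolding S0_def using T_convergent[of "max t 0" x] by (simp add: convergent_LIMSEQ_iff)

lemma S0_contraction: "p (S0 t x) \<le> p x"
  by (rule p_limit_le[OF S0_limit' T_contraction])

lemma S0_bounded_linear: "bounded_linear (S0 t)"
proof (rule bounded_linear_intro[of _ "M / m"])
  fix x y r
  show "S0 t (x + y) = S0 t x + S0 t y"
    using LIMSEQ_unique[OF S0_limit'[of t "x + y"]] tendsto_add[OF S0_limit' S0_limit'[of t]]
    by (simp add: linear_add[OF T_linear])
  show "S0 t (r *\<^sub>R x) = r *\<^sub>R S0 t x"
    using LIMSEQ_unique[OF S0_limit'[of t "r *\<^sub>R x"]] tendsto_scaleR[OF tendsto_const S0_limit'[of t]]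
    by (simp add: linear_scale[OF T_linear])
  have "m * norm (S0 t x) \<le> M * norm x"
    using p_lower S0_contraction p_upper by (meson order_trans)
  then show "norm (S0 t x) \<le> norm x * (M / m)"
    using m_pos by (simp add: field_simps)
qed

lemma S0_linear: "linear (S0 t)"
  by (rule bounded_linear.linear[OF S0_bounded_linear])

text \<open>Strong limits of contractions may be multiplied, and at level \<open>k\<close> the two
  sides differ by at most one Euler step, which costs \<open>p (A y) / 2 ^ k\<close> for
  \<open>y\<close> in \<open>D\<close>. Density and contractivity then cover all vectors.\<close>

lemma S0_add:
  assumes "0 \<le> s" "0 \<le> t"
  shows "S0 (s + t) x = S0 s (S0 t x)"
proof -
  have lim: "(\<lambda>k. T k s (T k t x)) \<longlonglongrightarrow> S0 s (S0 t x)" for x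
  proof (rule tendstoI_p)
    fix e :: real assume e: "0 < e"
    have "(\<lambda>k. p (T k t x - S0 t x) + p (T k s (S0 t x) - S0 s (S0 t x))) \<longlonglongrightarrow> p 0 + p 0"
      by (intro tendsto_add p_tendsto LIM_zero S0_limit assms)
    then have "\<forall>\<^sub>F k in sequentially. p (T k t x - S0 t x) + p (T k s (S0 t x) - S0 s (S0 t x)) < e"
      using e by (intro order_tendstoD) (auto simp: p_zero)
    then show "\<forall>\<^sub>F k in sequentially. p (T k s (T k t x) - S0 s (S0 t x)) < e"
    proof (rule eventually_mono)
      fix k
      have "p (T k s (T k t x) - T k s (S0 t x)) \<le> p (T k t x - S0 t x)"
        using T_contraction[of k s "T k t x - S0 t x"] by (simp add: linear_diff[OF T_linear])
      then show "p (T k s (T k t x) - S0 s (S0 t x)) < e"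
        if "p (T k t x - S0 t x) + p (T k s (S0 t x) - S0 s (S0 t x)) < e"
        using that p_triangle[of "T k s (T k t x)" "S0 s (S0 t x)" "T k s (S0 t x)"] by linarith
    qed
  qed
  have core: "p (S0 (s + t) y - S0 s (S0 t y)) = 0" if y: "y \<in> D" for y
  proof -
    have *: "p (T k (s + t) y - T k s (T k t y)) \<le> (1 / 2) ^ k * p (A y)" for k
    proof -
      have h: "(0::real) < 1 / 2 ^ k" by simp
      have "(2::real) ^ k * (s + t) = 2 ^ k * s + 2 ^ k * t" by (simp add: algebra_simps)
      then have "T k (s + t) y = T k s (T k t y) \<or> T k (s + t) y = T k s (T k t (F (1 / 2 ^ k) y))"
        using nat_floor_add_cases[of "2 ^ k * s" "2 ^ k * t"] assms
        unfolding T_def by (auto simp: funpow_add funpow_swap1)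
      moreover have "p (T k s (T k t (F (1 / 2 ^ k) y)) - T k s (T k t y)) \<le> 1 / 2 ^ k * p (A y)"
        using order_trans[OF T_contraction order_trans[OF T_contraction F_diff_le[OF h y]]]
        by (simp add: linear_diff[OF T_linear])
      ultimately show ?thesis using p_nonneg[of "A y"] by (auto simp: p_zero power_one_over)
    qed
    have "(\<lambda>k. p (T k (s + t) y - T k s (T k t y))) \<longlonglongrightarrow> p (S0 (s + t) y - S0 s (S0 t y))"
      using assms by (intro p_tendsto tendsto_diff S0_limit lim) simp
    moreover have "(\<lambda>k. (1 / 2) ^ k * p (A y)) \<longlonglongrightarrow> 0 * p (A y)"
      by (intro tendsto_intros LIMSEQ_power_zero) simp
    ultimately have "p (S0 (s + t) y - S0 s (S0 t y)) \<le> 0 * p (A y)"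
      using * by (intro LIMSEQ_le) auto
    then show ?thesis using p_nonneg[of "S0 (s + t) y - S0 s (S0 t y)"] by simp
  qed
  have "p (S0 (s + t) x - S0 s (S0 t x)) \<le> 0 + e" if "0 < e" for e
  proof -
    have "0 < e / 2" using that by simp
    then obtain y where y: "y \<in> D" "p (x - y) < e / 2"
      by (rule domain_square_dense)
    have "p (S0 (s + t) x - S0 (s + t) y) \<le> p (x - y)"
      using S0_contraction[of "s + t" "x - y"] by (simp add: linear_diff[OF S0_linear])
    moreover have "p (S0 s (S0 t y) - S0 s (S0 t x)) \<le> p (x - y)"
      using order_trans[OF S0_contraction S0_contraction, of s t "y - x"]
      by (simp add: linear_diff[OF S0_linear] p_commute[of x y])
    ultimately show ?thesis
      using core[OF y(1)] y(2) p_triangle[of "S0 (s + t) x" "S0 s (S0 t x)" "S0 (s + t) y"]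
        p_triangle[of "S0 (s + t) y" "S0 s (S0 t x)" "S0 s (S0 t y)"] by linarith
  qed
  then have "p (S0 (s + t) x - S0 s (S0 t x)) \<le> 0" by (rule field_le_epsilon)
  then have "m * norm (S0 (s + t) x - S0 s (S0 t x)) \<le> 0"
    using p_lower by (rule order_trans[rotated])
  then show ?thesis using m_pos by (simp add: mult_le_0_iff)
qed

lemma S0_zero: "S0 0 x = x"
  using S0_limit[of 0 x] by (simp add: T_zero LIMSEQ_const_iff)

lemma S0_diff_le:
  assumes "0 \<le> t" "y \<in> D"
  shows "p (S0 t y - y) \<le> t * p (A y)"
  by (rule p_limit_le[OF tendsto_diff[OF S0_limit[OF assms(1)] tendsto_const] T_diff_le[OF assms]])

lemma S0_continuous: "((\<lambda>t. S0 t x) \<longlongrightarrow> x) (at_right 0)"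
proof (rule tendstoI_p)
  fix e :: real assume e: "0 < e"
  obtain y where y: "y \<in> D" "p (x - y) < e / 4"
    using domain_square_dense[of "e / 4" x] e by auto
  define d where "d = e / 4 / (p (A y) + 1)"
  have d: "0 < d" using e p_nonneg[of "A y"] by (simp add: d_def)
  show "\<forall>\<^sub>F t in at_right 0. p (S0 t x - x) < e"
    unfolding eventually_at_right_field
  proof (intro exI[of _ d] conjI allI impI d)
    fix t :: real assume t: "0 < t" "t < d"
    have "0 < p (A y) + 1" using p_nonneg[of "A y"] by simp
    then have "t * (p (A y) + 1) < e / 4"
      using t(2) by (simp only: d_def pos_less_divide_eq)
    then have "t * p (A y) \<le> e / 4" using t(1) by (simp add: distrib_left)
    then have "p (S0 t y - y) \<le> e / 4" using S0_diff_le[of t y] t y by simp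
    moreover have "p (S0 t x - S0 t y) \<le> p (x - y)"
      using S0_contraction[of t "x - y"] by (simp add: linear_diff[OF S0_linear])
    ultimately show "p (S0 t x - x) < e"
      using p_triangle[of "S0 t x" x "S0 t y"] p_triangle[of "S0 t y" x y] y(2) p_commute[of x y] e
      by linarith
  qed
qed

lemma S0_derivative_bound:
  assumes t: "0 \<le> t" and y: "y \<in> D" "z \<in> D"
  shows "p (S0 t y - y - t *\<^sub>R A y) \<le> t * (2 * p (A y - z) + t * p (A z))"
proof (rule p_limit_le)
  let ?n = "\<lambda>k. nat \<lfloor>2 ^ k * t\<rfloor> * (1 / 2 ^ k)"
  \<comment> \<open>The rounded time falls short of \<open>t\<close> by at most one step, that is by
    \<open>(1 / 2) ^ k\<close>.\<close>
  have "?n \<longlonglongrightarrow> t"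
  proof (rule tendsto_sandwich)
    show "\<forall>\<^sub>F k in sequentially. t - (1 / 2) ^ k \<le> ?n k"
    proof (intro always_eventually allI)
      fix k :: nat
      have "2 ^ k * t \<le> nat \<lfloor>2 ^ k * t\<rfloor> + 1" using t by linarith
      then have "2 ^ k * t / 2 ^ k \<le> (nat \<lfloor>2 ^ k * t\<rfloor> + 1) / 2 ^ k"
        by (rule divide_right_mono) simp
      then show "t - (1 / 2) ^ k \<le> ?n k" by (simp add: add_divide_distrib power_one_over)
    qed
    show "\<forall>\<^sub>F k in sequentially. ?n k \<le> t" using step_count_le[OF t] by simp
    have "(\<lambda>k. t - (1 / 2) ^ k) \<longlonglongrightarrow> t - 0"
      by (intro tendsto_intros LIMSEQ_power_zero) simp
    then show "(\<lambda>k. t - (1 / 2) ^ k) \<longlonglongrightarrow> t" by simp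
  qed simp
  then show "(\<lambda>k. T k t y - y - ?n k *\<^sub>R A y) \<longlonglongrightarrow> S0 t y - y - t *\<^sub>R A y"
    by (intro tendsto_intros S0_limit t)
  fix k :: nat
  have "p (T k t y - y - ?n k *\<^sub>R A y) \<le> ?n k * (2 * p (A y - z) + ?n k * p (A z))"
    unfolding T_def by (rule F_pow_derivative) (use y in auto)
  also have "\<dots> \<le> t * (2 * p (A y - z) + t * p (A z))"
    using step_count_le[OF t, of k] p_nonneg[of "A z"] p_nonneg[of "A y - z"] t
    by (intro mult_mono add_mono add_nonneg_nonneg mult_nonneg_nonneg) auto
  finally show "p (T k t y - y - ?n k *\<^sub>R A y) \<le> t * (2 * p (A y - z) + t * p (A z))" .
qed

lemma S0_derivative:
  assumes y: "y \<in> D"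
  shows "((\<lambda>t. (S0 t y - y) /\<^sub>R t) \<longlongrightarrow> A y) (at_right 0)"
proof (rule tendstoI_p)
  fix e :: real assume e: "0 < e"
  obtain z where z: "z \<in> D" "p (A y - z) < e / 4"
    using domain_square_dense[of "e / 4" "A y"] e by auto
  define d where "d = e / 2 / (p (A z) + 1)"
  have d: "0 < d" using e p_nonneg[of "A z"] by (simp add: d_def)
  show "\<forall>\<^sub>F t in at_right 0. p ((S0 t y - y) /\<^sub>R t - A y) < e"
    unfolding eventually_at_right_field
  proof (intro exI[of _ d] conjI allI impI d)
    fix t :: real assume t: "0 < t" "t < d"
    have "0 < p (A z) + 1" using p_nonneg[of "A z"] by simp
    then have "t * (p (A z) + 1) < e / 2"
      using t(2) by (simp only: d_def pos_less_divide_eq)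
    then have "t * p (A z) \<le> e / 2" using t(1) by (simp add: distrib_left)
    then have *: "2 * p (A y - z) + t * p (A z) < e" using z by linarith
    have "(S0 t y - y) /\<^sub>R t - A y = (S0 t y - y - t *\<^sub>R A y) /\<^sub>R t"
      using t by (simp add: algebra_simps)
    then have "p ((S0 t y - y) /\<^sub>R t - A y) = p (S0 t y - y - t *\<^sub>R A y) / t"
      using t by (simp add: p_scale divide_inverse mult.commute)
    also have "\<dots> \<le> 2 * p (A y - z) + t * p (A z)"
      using S0_derivative_bound[of t y z] t y z by (simp add: pos_divide_le_eq mult.commute)
    finally show "p ((S0 t y - y) /\<^sub>R t - A y) < e" using * by linarith
  qed
qed

text \<open>If \<open>x\<close> is in the domain of the generator, then \<open>v = x - R(1,A)(x - y)\<close> is an eigenvector for the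
  eigenvalue \<open>1\<close>, which a contraction semigroup does not have unless \<open>v = 0\<close>.\<close>

lemma S0_generator_dom:
  assumes x: "((\<lambda>t. (S0 t x - x) /\<^sub>R t) \<longlongrightarrow> y) (at_right 0)"
  shows "x \<in> D"
proof -
  have r1: "regular D A 1" by (rule reg) simp
  define u where "u = resolvent D A 1 (x - y)"
  have u: "u \<in> D" "A u = u - (x - y)"
    using resolvent_in_dom[OF r1] op_resolvent[OF r1] by (auto simp: u_def)
  define v where "v = x - u"
  have "((\<lambda>t. (S0 t x - x) /\<^sub>R t - (S0 t u - u) /\<^sub>R t) \<longlongrightarrow> y - A u) (at_right 0)"
    by (intro tendsto_diff x S0_derivative u)
  then have "((\<lambda>t. (S0 t v - v) /\<^sub>R t) \<longlongrightarrow> v) (at_right 0)"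
    unfolding v_def u(2) by (simp add: linear_diff[OF S0_linear] algebra_simps)
  then have "((\<lambda>t. p ((S0 t v - v) /\<^sub>R t - v)) \<longlongrightarrow> p 0) (at_right 0)"
    by (intro p_tendsto LIM_zero)
  moreover have "\<forall>\<^sub>F t in at_right 0. p v \<le> p ((S0 t v - v) /\<^sub>R t - v)"
    unfolding eventually_at_right_field
  proof (intro exI[of _ 1] conjI allI impI)
    fix t :: real assume t: "0 < t" "t < 1"
    \<comment> \<open>\<open>S0 t v\<close> equals \<open>(1 + t) *\<^sub>R v\<close> plus
      \<open>t\<close> times the deviation of the difference quotient from \<open>v\<close>. As
      \<open>p (S0 t v) \<le> p v\<close>, that deviation has size at least \<open>p v\<close>,
      although it tends to zero.\<close>
    have "(1 + t) * p v = p (S0 t v - t *\<^sub>R ((S0 t v - v) /\<^sub>R t - v))"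
      using p_scale[of "1 + t" v] t by (simp add: algebra_simps)
    also have "\<dots> \<le> p v + t * p ((S0 t v - v) /\<^sub>R t - v)"
      using p_diff[of "S0 t v" "t *\<^sub>R ((S0 t v - v) /\<^sub>R t - v)"] S0_contraction[of t v] t
      by (simp add: p_scale)
    finally show "p v \<le> p ((S0 t v - v) /\<^sub>R t - v)" using t by (simp add: algebra_simps)
  qed simp
  ultimately have "p v \<le> p 0"
    by (intro tendsto_lowerbound) auto
  then have "m * norm v \<le> 0" using p_lower[of v] p_zero by linarith
  then have "v = 0" using m_pos by (simp add: mult_le_0_iff)
  then show ?thesis using u by (simp add: v_def)
qed

text \<open>The Euler steps are multiples \<open>r R(r)\<close> of resolvents, so a closed set
  preserved by these is preserved by their products and by the limit. The set is left arbitrary; the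
  positive cone is substituted later.\<close>

theorem generates_contraction_semigroup:
  obtains S where "generates D A S" "\<And>t x. 0 \<le> t \<Longrightarrow> p (blinfun_apply (S t) x) \<le> p x"
    "\<And>C t x. closed C \<Longrightarrow> (\<And>r x. 0 < r \<Longrightarrow> x \<in> C \<Longrightarrow> r *\<^sub>R resolvent D A r x \<in> C) \<Longrightarrow>
      0 \<le> t \<Longrightarrow> x \<in> C \<Longrightarrow> blinfun_apply (S t) x \<in> C"
proof -
  define S where "S t = Blinfun (S0 t)" for t
  have S: "blinfun_apply (S t) = S0 t" for t
    unfolding S_def by (rule bounded_linear_Blinfun_apply[OF S0_bounded_linear])
  have C0: "C0_semigroup S"
    unfolding C0_semigroup_def
    by (auto intro!: blinfun_eqI simp: S S0_zero S0_add S0_continuous)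
  have dom: "D = gen_dom S"
    unfolding gen_dom_def S using S0_derivative S0_generator_dom by blast
  have "A x = gen_op S x" if "x \<in> D" for x
    unfolding gen_op_def S by (rule tendsto_Lim[symmetric, OF _ S0_derivative[OF that]]) simp
  with C0 dom have gen: "generates D A S" by (simp add: generates_def)
  have inv: "S0 t x \<in> C" if C: "closed C" "\<And>r x. 0 < r \<Longrightarrow> x \<in> C \<Longrightarrow> r *\<^sub>R resolvent D A r x \<in> C"
    "0 \<le> t" "x \<in> C" for C t x
  proof -
    have "(F h ^^ n) x \<in> C" if "0 < h" for h n
      by (induction n) (use that C in \<open>auto simp: F_def\<close>)
    then have "T k t x \<in> C" for k unfolding T_def by simp
    then show ?thesis using closed_sequentially[OF C(1) _ S0_limit[OF C(3)]] by blast
  qed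
  show ?thesis using that[OF gen] S0_contraction inv unfolding S by blast
qed

end

section \<open>Integrals of orbits and the growth bound\<close>

text \<open>Riemann sums of a nonnegative function are nonnegative and come arbitrarily close to the
  integral, and the cone is closed.\<close>

lemma integral_nonneg_lattice:
  fixes f :: "real \<Rightarrow> 'a::banach_lattice"
  assumes "f integrable_on {a..b}" "\<And>x. x \<in> {a..b} \<Longrightarrow> 0 \<le> f x"
  shows "0 \<le> integral {a..b} f"
proof -
  have "\<exists>y\<in>{0..}. dist y (integral {a..b} f) < e" if "0 < e" for e
  proof -
    have "(f has_integral integral {a..b} f) (cbox a b)"
      using assms(1) by (simp add: has_integral_integral)
    from this[unfolded has_integral, rule_format, OF that]
    obtain \<gamma> where "gauge \<gamma> \<and> (\<forall>P. P tagged_division_of cbox a b \<and> \<gamma> fine P \<longrightarrow>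
        norm ((\<Sum>(x, k)\<in>P. measure lborel k *\<^sub>R f x) - integral {a..b} f) < e)" ..
    then have \<gamma>: "gauge \<gamma>" "\<And>P. P tagged_division_of cbox a b \<Longrightarrow> \<gamma> fine P \<Longrightarrow>
        norm ((\<Sum>(x, k)\<in>P. measure lborel k *\<^sub>R f x) - integral {a..b} f) < e"
      by auto
    obtain P where P: "P tagged_division_of cbox a b" "\<gamma> fine P"
      using fine_division_exists[OF \<gamma>(1)] by blast
    have "0 \<le> (\<Sum>(x, k)\<in>P. measure lborel k *\<^sub>R f x)"
    proof (rule sum_nonneg)
      fix xk assume xk: "xk \<in> P"
      obtain x k where [simp]: "xk = (x, k)" by fastforce
      have "x \<in> {a..b}" using tagged_division_ofD(2,3)[OF P(1), of x k] xk by auto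
      then show "0 \<le> (case xk of (x, k) \<Rightarrow> measure lborel k *\<^sub>R f x)"
        using assms(2) by (simp add: scaleR_nonneg_nonneg)
    qed
    then show ?thesis using \<gamma>(2)[OF P] by (auto simp: dist_norm)
  qed
  then show ?thesis
    using closed_approachable[OF closed_nonneg_cone, of "integral {a..b} f"] by simp
qed

lemma integral_right_derivative:
  fixes f :: "real \<Rightarrow> 'a::banach"
  assumes f: "continuous_on {a..} f" and t: "a \<le> t"
  shows "((\<lambda>h. (integral {a..t + h} f - integral {a..t} f) /\<^sub>R h) \<longlongrightarrow> f t) (at_right 0)"
proof (rule tendstoI)
  fix e :: real assume e: "0 < e"
  obtain d where d: "0 < d" "\<And>s. a \<le> s \<Longrightarrow> dist s t < d \<Longrightarrow> dist (f s) (f t) < e / 2"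
    using f e t unfolding continuous_on_iff by (meson atLeast_iff half_gt_zero)
  have cont: "continuous_on {u..v} f" if "a \<le> u" for u v
    by (rule continuous_on_subset[OF f]) (use that in auto)
  show "\<forall>\<^sub>F h in at_right 0. dist ((integral {a..t + h} f - integral {a..t} f) /\<^sub>R h) (f t) < e"
    unfolding eventually_at_right_field
  proof (intro exI[of _ d] conjI allI impI d)
    fix h :: real assume h: "0 < h" "h < d"
    have "integral {a..t} f + integral {t..t + h} f = integral {a..t + h} f"
      using h t by (intro Henstock_Kurzweil_Integration.integral_combine
          integrable_continuous_real cont) auto
    then have "integral {a..t + h} f - integral {a..t} f - h *\<^sub>R f t
        = integral {t..t + h} f - integral {t..t + h} (\<lambda>_. f t)"
      using h by (simp add: algebra_simps)
    also have "\<dots> = integral {t..t + h} (\<lambda>s. f s - f t)"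
      by (rule Henstock_Kurzweil_Integration.integral_diff[symmetric])
        (use t in \<open>auto intro!: integrable_continuous_real cont continuous_intros\<close>)
    also have "norm \<dots> \<le> e / 2 * (t + h - t)"
    proof (rule integral_bound)
      show "continuous_on {t..t + h} (\<lambda>s. f s - f t)"
        using t by (intro continuous_intros cont)
      fix s assume "s \<in> {t..t + h}"
      then show "norm (f s - f t) \<le> e / 2"
        using d(2)[of s] h t by (auto simp: dist_norm less_imp_le)
    qed (use h in auto)
    also have "\<dots> < e * h" using e h by simp
    finally have *: "norm (integral {a..t + h} f - integral {a..t} f - h *\<^sub>R f t) < e * h" .
    have "(integral {a..t + h} f - integral {a..t} f) /\<^sub>R h - f t
        = (integral {a..t + h} f - integral {a..t} f - h *\<^sub>R f t) /\<^sub>R h"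
      using h by (simp add: algebra_simps)
    then have "dist ((integral {a..t + h} f - integral {a..t} f) /\<^sub>R h) (f t)
        = norm (integral {a..t + h} f - integral {a..t} f - h *\<^sub>R f t) / h"
      using h by (simp add: dist_norm divide_inverse_commute)
    then show "dist ((integral {a..t + h} f - integral {a..t} f) /\<^sub>R h) (f t) < e"
      using * h by (simp add: pos_divide_less_eq)
  qed
qed

text \<open>For the semigroups constructed here the local bound is explicit: it comes from
  contractivity in the equivalent norm and is inherited by rescaled and complexified
  semigroups.\<close>

locale locally_bounded_semigroup =
  fixes U :: "real \<Rightarrow> 'a::banach \<Rightarrow>\<^sub>L 'a"
  assumes C0: "C0_semigroup U"
    and locally_bounded: "\<exists>K. \<forall>t\<in>{0..b}. norm (U t) \<le> K"
begin

lemma U_zero [simp]: "U 0 x = x"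
  and U_add: "0 \<le> s \<Longrightarrow> 0 \<le> t \<Longrightarrow> U (s + t) x = U s (U t x)"
  and U_right: "((\<lambda>t. U t x) \<longlongrightarrow> x) (at_right 0)"
  using C0 by (auto simp: C0_semigroup_def)

lemma U_commute: "0 \<le> s \<Longrightarrow> 0 \<le> t \<Longrightarrow> U s (U t x) = U t (U s x)"
  by (metis U_add add.commute)

text \<open>Continuity is given at \<open>0\<close> from the right only. For \<open>u < v\<close>
  the increment is \<open>U u (U (v - u) x - x)\<close>, and the local bound makes it small
  uniformly in \<open>u\<close>; letting \<open>u\<close> vary below a fixed \<open>v\<close> gives
  continuity from the left.\<close>

lemma continuous_orbit: "continuous_on {0..} (\<lambda>t. U t x)"
  unfolding continuous_on_iff
proof (intro ballI allI impI)
  fix t e :: real assume t: "t \<in> {0..}" and e: "0 < e"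
  obtain K where K: "\<And>s. s \<in> {0..t + 1} \<Longrightarrow> norm (U s) \<le> K"
    using locally_bounded by blast
  have "norm (U 0) \<le> K" by (rule K) (use t in simp)
  then have K0: "0 \<le> K" using norm_ge_zero[of "U 0"] by linarith
  have "0 < e / (K + 1)" using e K0 by simp
  then have "\<forall>\<^sub>F h in at_right 0. dist (U h x) x < e / (K + 1)"
    by (rule tendstoD[OF U_right])
  then obtain d where d: "0 < d" "\<And>h. 0 < h \<Longrightarrow> h < d \<Longrightarrow> dist (U h x) x < e / (K + 1)"
    unfolding eventually_at_right_field by blast
  have main: "norm (U v x - U u x) < e" if "0 \<le> u" "u < v" "v < u + d" "v \<le> t + 1" for u v
  proof -
    have "U v x - U u x = U u (U (v - u) x - x)"
      using U_add[of u "v - u" x] that by (simp add: blinfun.diff_right)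
    also have "norm \<dots> \<le> K * norm (U (v - u) x - x)"
      by (rule order_trans[OF norm_blinfun mult_right_mono[OF K]]) (use that in auto)
    also have "\<dots> \<le> (K + 1) * norm (U (v - u) x - x)" by (intro mult_right_mono) auto
    also have "\<dots> < e"
      using d(2)[of "v - u"] that K0 by (simp add: dist_norm pos_less_divide_eq mult.commute)
    finally show ?thesis .
  qed
  show "\<exists>d>0. \<forall>s\<in>{0..}. dist s t < d \<longrightarrow> dist (U s x) (U t x) < e"
  proof (intro exI[of _ "min d 1"] conjI ballI impI)
    fix s :: real assume s: "s \<in> {0..}" "dist s t < min d 1"
    consider "s = t" | "s < t" | "t < s" by linarith
    then show "dist (U s x) (U t x) < e"
    proof cases
      case 2
      then show ?thesis using main[of s t] s t
        by (auto simp: dist_norm dist_real_def norm_minus_commute)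
    next
      case 3
      then show ?thesis using main[of t s] s t by (auto simp: dist_norm dist_real_def)
    qed (use e in auto)
  qed (use d in auto)
qed

lemma integrable_orbit: "0 \<le> a \<Longrightarrow> (\<lambda>s. U s x) integrable_on {a..b}"
  by (intro integrable_continuous_real continuous_on_subset[OF continuous_orbit]) auto

definition W :: "real \<Rightarrow> 'a \<Rightarrow> 'a" where
  "W t x = integral {0..t} (\<lambda>s. U s x)"

lemma W_zero: "W 0 x = 0"
  by (simp add: W_def)

lemma bounded_linear_W:
  assumes t: "0 \<le> t"
  shows "bounded_linear (W t)"
proof -
  obtain K where K: "\<And>s. s \<in> {0..t} \<Longrightarrow> norm (U s) \<le> K"
    using locally_bounded by blast
  show ?thesis
  proof (rule bounded_linear_intro[of _ "K * t"])
    fix x y r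
    show "W t (x + y) = W t x + W t y"
      unfolding W_def blinfun.add_right
      by (intro Henstock_Kurzweil_Integration.integral_add integrable_orbit) simp_all
    show "W t (r *\<^sub>R x) = r *\<^sub>R W t x"
      unfolding W_def blinfun.scaleR_right by simp
    have "norm (W t x) \<le> (K * norm x) * (t - 0)"
      unfolding W_def
    proof (rule integral_bound[OF t])
      show "continuous_on {0..t} (\<lambda>s. U s x)"
        by (rule continuous_on_subset[OF continuous_orbit]) auto
      show "norm (U s x) \<le> K * norm x" if "s \<in> {0..t}" for s
        by (rule order_trans[OF norm_blinfun mult_right_mono[OF K[OF that]]]) simp
    qed
    then show "norm (W t x) \<le> norm x * (K * t)" by (simp add: algebra_simps)
  qed
qed

lemma U_W:
  assumes "0 \<le> t" "0 \<le> h"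
  shows "U h (W t x) = W (t + h) x - W h x"
proof -
  have "U h (W t x) = integral {0..t} (\<lambda>s. U h (U s x))"
    unfolding W_def
    using integral_linear[OF integrable_orbit[of 0 x t] blinfun.bounded_linear_right[of "U h"]]
    by (simp add: o_def)
  also have "\<dots> = integral {0..t} ((\<lambda>s. U s x) \<circ> (+) h)"
    using assms(2) by (intro Henstock_Kurzweil_Integration.integral_cong) (simp add: U_add[symmetric])
  also have "\<dots> = integral {0 + h..t + h} (\<lambda>s. U s x)"
    by (rule integral_shift_Icc_real)
  also have "\<dots> = W (t + h) x - W h x"
    using Henstock_Kurzweil_Integration.integral_combine[of 0 h "t + h" "\<lambda>s. U s x"]
      integrable_orbit[of 0] assms
    unfolding W_def by (simp add: algebra_simps)
  finally show ?thesis .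
qed

lemma W_U:
  assumes "0 \<le> h"
  shows "W t (U h x) = U h (W t x)"
proof -
  have "U h (W t x) = integral {0..t} (\<lambda>s. U h (U s x))"
    unfolding W_def
    using integral_linear[OF integrable_orbit[of 0 x t] blinfun.bounded_linear_right[of "U h"]]
    by (simp add: o_def)
  also have "\<dots> = W t (U h x)"
    unfolding W_def using assms by (intro Henstock_Kurzweil_Integration.integral_cong) (simp add: U_commute)
  finally show ?thesis by simp
qed

text \<open>\<open>U h\<close> shifts the interval of integration, so the difference quotient of
  \<open>W t x\<close> is the difference of two quotients of the primitive, at time \<open>t\<close>
  and at time \<open>0\<close>. In particular \<open>W t\<close> maps every vector into the domain
  of the generator.\<close>

lemma W_generator:
  assumes "0 \<le> t"
  shows "((\<lambda>h. (U h (W t x) - W t x) /\<^sub>R h) \<longlongrightarrow> U t x - x) (at_right 0)"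
proof -
  have "((\<lambda>h. (W (t + h) x - W t x) /\<^sub>R h - (W (0 + h) x - W 0 x) /\<^sub>R h) \<longlongrightarrow> U t x - U 0 x) (at_right 0)"
    unfolding W_def by (intro tendsto_diff integral_right_derivative continuous_orbit assms order_refl)
  moreover have "\<forall>\<^sub>F h in at_right 0. (W (t + h) x - W t x) /\<^sub>R h - (W (0 + h) x - W 0 x) /\<^sub>R h
      = (U h (W t x) - W t x) /\<^sub>R h"
    unfolding eventually_at_right_field
    by (intro exI[of _ 1]) (auto simp: U_W assms W_zero algebra_simps)
  ultimately show ?thesis by (simp add: Lim_transform_eventually)
qed

text \<open>The bounded map \<open>W t\<close> commutes with \<open>U h\<close> and can therefore be
  moved inside the difference quotient, where \<open>W_generator\<close> supplies the limit; the
  orbit itself is never differentiated.\<close>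

lemma W_derivative:
  assumes t: "0 \<le> t" and y: "((\<lambda>h. (U h x - x) /\<^sub>R h) \<longlongrightarrow> y) (at_right 0)"
  shows "W t y = U t x - x"
proof (rule tendsto_unique)
  interpret W: bounded_linear "W t" by (rule bounded_linear_W[OF t])
  show "((\<lambda>h. W t ((U h x - x) /\<^sub>R h)) \<longlongrightarrow> W t y) (at_right 0)"
    by (rule W.tendsto[OF y])
  have "\<forall>\<^sub>F h in at_right 0. (U h (W t x) - W t x) /\<^sub>R h = W t ((U h x - x) /\<^sub>R h)"
    unfolding eventually_at_right_field
    by (intro exI[of _ 1]) (auto simp: W.scaleR W.diff W_U)
  then show "((\<lambda>h. W t ((U h x - x) /\<^sub>R h)) \<longlongrightarrow> U t x - x) (at_right 0)"
    by (rule Lim_transform_eventually[OF W_generator[OF t]])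
qed simp

end

section \<open>Generators, their resolvents and exponential rescaling\<close>

lemma generates_derivative:
  assumes "generates D A S" "x \<in> D"
  shows "((\<lambda>t. (blinfun_apply (S t) x - x) /\<^sub>R t) \<longlongrightarrow> A x) (at_right 0)"
proof -
  obtain y where y: "((\<lambda>t. (blinfun_apply (S t) x - x) /\<^sub>R t) \<longlongrightarrow> y) (at_right 0)"
    using assms by (auto simp: generates_def gen_dom_def)
  then have "A x = y"
    using assms tendsto_Lim[OF _ y] by (simp add: generates_def gen_op_def)
  then show ?thesis using y by simp
qed

lemma generates_dom:
  assumes "generates D A S" "((\<lambda>t. (blinfun_apply (S t) x - x) /\<^sub>R t) \<longlongrightarrow> y) (at_right 0)"
  shows "x \<in> D" "A x = y"
proof -
  show "x \<in> D" using assms by (auto simp: generates_def gen_dom_def)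
  then show "A x = y"
    using tendsto_unique[OF _ generates_derivative[OF assms(1)] assms(2)] by simp
qed

lemma generates_commute:
  assumes gen: "generates D A S" and t: "0 \<le> t" and x: "x \<in> D"
  shows "blinfun_apply (S t) x \<in> D" "A (blinfun_apply (S t) x) = blinfun_apply (S t) (A x)"
proof -
  have "((\<lambda>h. blinfun_apply (S t) ((blinfun_apply (S h) x - x) /\<^sub>R h)) \<longlongrightarrow> blinfun_apply (S t) (A x)) (at_right 0)"
    by (intro blinfun.tendsto tendsto_const generates_derivative[OF gen x])
  moreover have "\<forall>\<^sub>F h in at_right 0. blinfun_apply (S t) ((blinfun_apply (S h) x - x) /\<^sub>R h)
      = (blinfun_apply (S h) (blinfun_apply (S t) x) - blinfun_apply (S t) x) /\<^sub>R h"
    unfolding eventually_at_right_field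
  proof (intro exI[of _ 1] conjI allI impI)
    fix h :: real assume "0 < h"
    then have "S (t + h) = S t o\<^sub>L S h" "S (h + t) = S h o\<^sub>L S t"
      using gen t by (auto simp: generates_def C0_semigroup_def)
    then have "blinfun_apply (S t) (blinfun_apply (S h) x) = blinfun_apply (S h) (blinfun_apply (S t) x)"
      by (metis add.commute blinfun_apply_blinfun_compose)
    then show "blinfun_apply (S t) ((blinfun_apply (S h) x - x) /\<^sub>R h)
      = (blinfun_apply (S h) (blinfun_apply (S t) x) - blinfun_apply (S t) x) /\<^sub>R h"
      by (simp add: blinfun.scaleR_right blinfun.diff_right)
  qed simp
  ultimately have "((\<lambda>h. (blinfun_apply (S h) (blinfun_apply (S t) x) - blinfun_apply (S t) x) /\<^sub>R h)
      \<longlongrightarrow> blinfun_apply (S t) (A x)) (at_right 0)"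
    by (rule Lim_transform_eventually)
  then show "blinfun_apply (S t) x \<in> D" "A (blinfun_apply (S t) x) = blinfun_apply (S t) (A x)"
    by (rule generates_dom[OF gen])+
qed

lemma generates_resolvent_commute:
  assumes gen: "generates D A S" and t: "0 \<le> t" and r: "regular D A r"
  shows "blinfun_apply (S t) (resolvent D A r x) = resolvent D A r (blinfun_apply (S t) x)"
proof -
  let ?u = "resolvent D A r x"
  have u: "?u \<in> D" by (rule resolvent_in_dom[OF r])
  have "r *\<^sub>R S t ?u - A (S t ?u) = S t (r *\<^sub>R ?u - A ?u)"
    using generates_commute(2)[OF gen t u] by (simp add: blinfun.diff_right blinfun.scaleR_right)
  then show ?thesis
    using resolvent_left[OF r generates_commute(1)[OF gen t u]] resolvent_right[OF r, of x] by simp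
qed

lemma C0_semigroup_rescale:
  assumes "C0_semigroup S"
  shows "C0_semigroup (\<lambda>t. exp (c * t) *\<^sub>R S t)"
proof -
  have "((\<lambda>t. exp (c * t) *\<^sub>R blinfun_apply (S t) x) \<longlongrightarrow> exp (c * 0) *\<^sub>R x) (at_right 0)" for x
    using assms by (intro tendsto_intros) (simp add: C0_semigroup_def)
  then show ?thesis
    using assms unfolding C0_semigroup_def
    by (auto simp: blinfun.scaleR_left blinfun.scaleR_right exp_add algebra_simps intro!: blinfun_eqI)
qed

lemma rescale_derivative:
  assumes S: "C0_semigroup S" and x: "((\<lambda>t. (blinfun_apply (S t) x - x) /\<^sub>R t) \<longlongrightarrow> y) (at_right 0)"
  shows "((\<lambda>t. (blinfun_apply (exp (c * t) *\<^sub>R S t) x - x) /\<^sub>R t) \<longlongrightarrow> y + c *\<^sub>R x) (at_right 0)"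
proof -
  have "((\<lambda>t. exp (c * t)) has_field_derivative c) (at_right 0)"
    by (auto intro!: derivative_eq_intros)
  then have "((\<lambda>t. (exp (c * t) - 1) / t) \<longlongrightarrow> c) (at_right 0)"
    by (simp add: has_field_derivative_iff)
  then have "((\<lambda>t. exp (c * t) *\<^sub>R ((S t x - x) /\<^sub>R t) + ((exp (c * t) - 1) / t) *\<^sub>R x)
      \<longlongrightarrow> exp (c * 0) *\<^sub>R y + c *\<^sub>R x) (at_right 0)"
    by (intro tendsto_intros x)
  moreover have "exp (c * t) *\<^sub>R ((S t x - x) /\<^sub>R t) + ((exp (c * t) - 1) / t) *\<^sub>R x
      = (blinfun_apply (exp (c * t) *\<^sub>R S t) x - x) /\<^sub>R t" for t
    by (simp add: blinfun.scaleR_left algebra_simps divide_inverse)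
  ultimately show ?thesis by simp
qed

lemma generates_rescale:
  assumes gen: "generates D A S"
  shows "generates D (\<lambda>x. A x + c *\<^sub>R x) (\<lambda>t. exp (c * t) *\<^sub>R S t)"
proof -
  have S: "C0_semigroup S" using gen by (simp add: generates_def)
  let ?V = "\<lambda>t. exp (c * t) *\<^sub>R S t"
  have V: "C0_semigroup ?V" by (rule C0_semigroup_rescale[OF S])
  \<comment> \<open>Rescaling by \<open>- c\<close> recovers \<open>S\<close>, so
    \<open>rescale_derivative\<close> also yields the reverse inclusion of the domains.\<close>
  have inv: "exp (- c * t) *\<^sub>R ?V t = S t" for t
    by (simp add: exp_minus)
  have d: "((\<lambda>t. (?V t x - x) /\<^sub>R t) \<longlongrightarrow> A x + c *\<^sub>R x) (at_right 0)" if "x \<in> D" for x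
    by (rule rescale_derivative[OF S generates_derivative[OF gen that]])
  have "x \<in> D" if "((\<lambda>t. (?V t x - x) /\<^sub>R t) \<longlongrightarrow> y) (at_right 0)" for x y
    using rescale_derivative[OF V that, of "- c"] generates_dom(1)[OF gen] unfolding inv by blast
  then have "D = gen_dom ?V" unfolding gen_dom_def using d by blast
  moreover have "A x + c *\<^sub>R x = gen_op ?V x" if "x \<in> D" for x
    unfolding gen_op_def by (rule tendsto_Lim[symmetric, OF _ d[OF that]]) simp
  ultimately show ?thesis using V by (simp add: generates_def)
qed

section \<open>The complexified semigroup and points of the resolvent set\<close>

lemma cscale_simps:
  "cscale a (z + w) = cscale a z + cscale a w"
  "cscale a (z - w) = cscale a z - cscale a w"
  "cscale a (r *\<^sub>R z) = r *\<^sub>R cscale a z"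
  "cscale (a + b) z = cscale a z + cscale b z"
  "cscale (a - b) z = cscale a z - cscale b z"
  "cscale (r *\<^sub>R a) z = r *\<^sub>R cscale a z"
  "cscale (- a) z = - cscale a z"
  "cscale (a * b) z = cscale a (cscale b z)"
  "cscale 1 z = z"
  by (auto simp: cscale_def prod_eq_iff algebra_simps)

lemma cscale_map_prod:
  assumes "linear f"
  shows "cscale a (map_prod f f z) = map_prod f f (cscale a z)"
  by (simp add: cscale_def prod_eq_iff linear_add[OF assms] linear_diff[OF assms] linear_scale[OF assms])

lemma norm_cscale_le: "norm (cscale a z) \<le> 4 * cmod a * norm z"
proof -
  have "norm (cscale a z) \<le> norm (fst (cscale a z)) + norm (snd (cscale a z))"
    by (metis norm_Pair_le prod.collapse)
  also have "\<dots> \<le> (\<bar>Re a\<bar> * norm (fst z) + \<bar>Im a\<bar> * norm (snd z))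
      + (\<bar>Im a\<bar> * norm (fst z) + \<bar>Re a\<bar> * norm (snd z))"
    unfolding cscale_def fst_conv snd_conv norm_scaleR[symmetric]
    by (intro add_mono norm_triangle_ineq norm_triangle_ineq4)
  also have "\<dots> \<le> (cmod a * norm z + cmod a * norm z) + (cmod a * norm z + cmod a * norm z)"
    by (intro add_mono mult_mono abs_Re_le_cmod abs_Im_le_cmod norm_fst_le[of "fst z" "snd z", unfolded prod.collapse]
        norm_snd_le[of "snd z" "fst z", unfolded prod.collapse]) auto
  finally show ?thesis by simp
qed

lemma norm_map_prod_le:
  assumes "\<And>x. norm (f x) \<le> K * norm x" "0 \<le> K"
  shows "norm (map_prod f f z) \<le> 2 * K * norm z"
proof -
  have "norm (map_prod f f z) \<le> norm (f (fst z)) + norm (f (snd z))"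
    by (metis fst_map_prod norm_Pair_le prod.collapse snd_map_prod)
  also have "\<dots> \<le> K * norm z + K * norm z"
    using assms by (intro add_mono order_trans[OF assms(1)] mult_left_mono norm_fst_le[of "fst z" "snd z", unfolded prod.collapse]
        norm_snd_le[of "snd z" "fst z", unfolded prod.collapse])
  finally show ?thesis by simp
qed

lemma tendsto_cscale:
  fixes z :: "'a::real_normed_vector \<times> 'a"
  assumes "(f \<longlongrightarrow> a) F" "(g \<longlongrightarrow> z) F"
  shows "((\<lambda>x. cscale (f x) (g x)) \<longlongrightarrow> cscale a z) F"
  unfolding cscale_def
  by (intro tendsto_Pair tendsto_add tendsto_diff tendsto_scaleR tendsto_Re tendsto_Im
      tendsto_fst tendsto_snd assms)

text \<open>Here \<open>U t\<close> stands for \<open>exp (- \<mu> t) S(t)\<close> on the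
  complexification. Its generator is \<open>A - \<mu>\<close> on \<open>D \<times> D\<close>, so an
  inverse of \<open>\<mu> - A\<close> can be sought among the orbit integrals of
  \<open>U\<close>.\<close>

locale complexified_semigroup = S: locally_bounded_semigroup S
  for S :: "real \<Rightarrow> 'a::banach \<Rightarrow>\<^sub>L 'a" +
  fixes D :: "'a set" and A :: "'a \<Rightarrow> 'a" and \<mu> :: complex
  assumes gen: "generates D A S"
begin

definition w :: "real \<Rightarrow> complex" where
  "w t = exp (- \<mu> * of_real t)"

definition V :: "real \<Rightarrow> 'a \<times> 'a \<Rightarrow> 'a \<times> 'a" where
  "V t z = map_prod (S t) (S t) z"

definition U :: "real \<Rightarrow> ('a \<times> 'a) \<Rightarrow>\<^sub>L ('a \<times> 'a)" where
  "U t = Blinfun (\<lambda>z. cscale (w t) (V t z))"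

lemma norm_w: "cmod (w t) = exp (- Re \<mu> * t)"
  by (simp add: w_def norm_exp_eq_Re)

lemma norm_V: "norm (V t z) \<le> 2 * norm (S t) * norm z"
  unfolding V_def by (rule norm_map_prod_le[OF norm_blinfun norm_ge_zero])

lemma norm_cscale_V: "norm (cscale (w t) (V t z)) \<le> 8 * (cmod (w t) * norm (S t)) * norm z"
proof -
  have "norm (cscale (w t) (V t z)) \<le> 4 * cmod (w t) * (2 * norm (S t) * norm z)"
    by (rule order_trans[OF norm_cscale_le mult_left_mono[OF norm_V]]) simp
  then show ?thesis by (simp add: algebra_simps)
qed

lemma U_apply: "blinfun_apply (U t) z = cscale (w t) (V t z)"
proof -
  have "bounded_linear (\<lambda>z. cscale (w t) (V t z))"
  proof (rule bounded_linear_intro)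
    show "norm (cscale (w t) (V t z)) \<le> norm z * (8 * (cmod (w t) * norm (S t)))" for z
      using norm_cscale_V[of t z] by (simp add: mult.commute)
  qed (auto simp: V_def cscale_def blinfun.bilinear_simps algebra_simps)
  then show ?thesis unfolding U_def by (simp add: bounded_linear_Blinfun_apply)
qed

lemma norm_U: "norm (U t) \<le> 8 * (cmod (w t) * norm (S t))"
  by (rule norm_blinfun_bound) (use norm_cscale_V in \<open>auto simp: U_apply\<close>)

lemma w_right: "(w \<longlongrightarrow> 1) (at_right 0)"
proof -
  have "((\<lambda>t. exp (- \<mu> * of_real t)) \<longlongrightarrow> exp (- \<mu> * of_real 0)) (at_right 0)"
    by (intro tendsto_intros)
  then show ?thesis by (simp add: w_def[abs_def])
qed

lemma w_derivative: "((\<lambda>t. (w t - 1) /\<^sub>R t) \<longlongrightarrow> - \<mu>) (at_right 0)"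
proof -
  have "((\<lambda>z. exp (- \<mu> * z)) has_field_derivative - \<mu>) (at 0)"
    by (auto intro!: derivative_eq_intros)
  then have *: "((\<lambda>z. (exp (- \<mu> * z) - 1) / z) \<longlongrightarrow> - \<mu>) (at 0)"
    by (simp add: has_field_derivative_iff)
  have "filterlim complex_of_real (at 0) (at_right 0)"
    unfolding filterlim_at
    by (auto intro!: tendsto_eq_intros simp: eventually_at_right_field intro: exI[of _ 1])
  from filterlim_compose[OF * this] show ?thesis
    by (simp add: w_def scaleR_conv_of_real divide_inverse mult.commute)
qed

sublocale U: locally_bounded_semigroup U
proof
  have S0: "S 0 = id_blinfun" and Sadd: "\<And>s t. 0 \<le> s \<Longrightarrow> 0 \<le> t \<Longrightarrow> S (s + t) = S s o\<^sub>L S t"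
    using S.C0 by (auto simp: C0_semigroup_def)
  have "U (s + t) = U s o\<^sub>L U t" if "0 \<le> s" "0 \<le> t" for s t
  proof (rule blinfun_eqI)
    fix z
    have "w (s + t) = w s * w t" by (simp add: w_def exp_add[symmetric] algebra_simps)
    then have "blinfun_apply (U (s + t)) z = cscale (w s) (cscale (w t) (V s (V t z)))"
      using that by (simp add: U_apply cscale_simps V_def Sadd map_prod_def split_beta)
    also have "cscale (w t) (V s (V t z)) = V s (cscale (w t) (V t z))"
      unfolding V_def by (rule cscale_map_prod[OF bounded_linear.linear[OF blinfun.bounded_linear_right]])
    finally show "blinfun_apply (U (s + t)) z = blinfun_apply (U s o\<^sub>L U t) z"
      by (simp add: U_apply)
  qed
  moreover have "U 0 = id_blinfun"
    by (rule blinfun_eqI) (simp add: U_apply w_def V_def S0 cscale_simps map_prod_def split_beta)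
  moreover have "((\<lambda>t. blinfun_apply (U t) z) \<longlongrightarrow> z) (at_right 0)" for z
  proof -
    have "((\<lambda>t. cscale (w t) (S t (fst z), S t (snd z))) \<longlongrightarrow> cscale 1 (fst z, snd z)) (at_right 0)"
      by (intro tendsto_cscale w_right tendsto_Pair S.U_right)
    then show ?thesis by (simp add: U_apply V_def map_prod_def split_beta cscale_simps)
  qed
  ultimately show "C0_semigroup U" by (simp add: C0_semigroup_def)
  fix b
  obtain K where K: "\<And>t. t \<in> {0..b} \<Longrightarrow> norm (S t) \<le> K"
    using S.locally_bounded by blast
  have "norm (U t) \<le> 8 * (exp (\<bar>Re \<mu>\<bar> * b) * K)" if "t \<in> {0..b}" for t
  proof -
    have "- Re \<mu> * t \<le> \<bar>Re \<mu>\<bar> * b" using that by (intro mult_mono) auto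
    then show ?thesis
      using that by (intro order_trans[OF norm_U] mult_left_mono mult_mono K) (auto simp: norm_w)
  qed
  then show "\<exists>K. \<forall>t\<in>{0..b}. norm (U t) \<le> K" by blast
qed

lemma U_generator:
  assumes "z \<in> D \<times> D"
  shows "((\<lambda>t. (U t z - z) /\<^sub>R t) \<longlongrightarrow> map_prod A A z - cscale \<mu> z) (at_right 0)"
proof -
  have "((\<lambda>t. ((S t (fst z) - fst z) /\<^sub>R t, (S t (snd z) - snd z) /\<^sub>R t)) \<longlongrightarrow> (A (fst z), A (snd z))) (at_right 0)"
    using assms by (intro tendsto_Pair generates_derivative[OF gen]) auto
  then have "((\<lambda>t. cscale (w t) ((V t z - z) /\<^sub>R t) + cscale ((w t - 1) /\<^sub>R t) z)
      \<longlongrightarrow> cscale 1 (map_prod A A z) + cscale (- \<mu>) z) (at_right 0)"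
    by (intro tendsto_add tendsto_cscale w_right w_derivative tendsto_const)
      (simp add: V_def map_prod_def split_beta minus_prod_def scaleR_prod_def)
  moreover have "cscale (w t) ((V t z - z) /\<^sub>R t) + cscale ((w t - 1) /\<^sub>R t) z = (U t z - z) /\<^sub>R t" for t
    by (simp add: U_apply cscale_simps algebra_simps)
  ultimately show ?thesis by (simp add: cscale_simps)
qed

text \<open>Multiplication by \<open>inverse (w t)\<close> undoes the scalar factor and leaves the
  difference quotients of \<open>S\<close> in the two components, each of which then
  converges.\<close>

lemma U_generator_dom:
  assumes l: "((\<lambda>t. (U t z - z) /\<^sub>R t) \<longlongrightarrow> l) (at_right 0)"
  shows "z \<in> D \<times> D"
proof -
  have "((\<lambda>t. cscale (inverse (w t)) ((U t z - z) /\<^sub>R t - cscale ((w t - 1) /\<^sub>R t) z))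
      \<longlongrightarrow> cscale (inverse 1) (l - cscale (- \<mu>) z)) (at_right 0)"
    by (intro tendsto_cscale tendsto_diff tendsto_inverse w_right w_derivative tendsto_const l) simp
  moreover have "cscale (inverse (w t)) ((U t z - z) /\<^sub>R t - cscale ((w t - 1) /\<^sub>R t) z) = (V t z - z) /\<^sub>R t" for t
  proof -
    have "(U t z - z) /\<^sub>R t - cscale ((w t - 1) /\<^sub>R t) z = cscale (w t) ((V t z - z) /\<^sub>R t)"
      by (simp add: U_apply cscale_simps algebra_simps)
    moreover have "inverse (w t) * w t = 1" by (simp add: w_def)
    ultimately show ?thesis by (simp add: cscale_simps(8)[symmetric] cscale_simps(9))
  qed
  ultimately have lim: "((\<lambda>t. (V t z - z) /\<^sub>R t) \<longlongrightarrow> cscale (inverse 1) (l - cscale (- \<mu>) z)) (at_right 0)"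
    by simp
  have "fst z \<in> D" "snd z \<in> D"
    using generates_dom(1)[OF gen, of "fst z"] generates_dom(1)[OF gen, of "snd z"]
      tendsto_fst[OF lim] tendsto_snd[OF lim] by (auto simp: V_def)
  then show ?thesis by (simp add: mem_Times_iff)
qed

lemma in_resolvent_set:
  assumes t: "0 < t" "norm (S t) < exp (Re \<mu> * t)"
  shows "\<mu> \<in> resolvent_set D A"
proof -
  let ?f = "\<lambda>z. cscale \<mu> z - map_prod A A z"
  define q where "q = cmod (w t) * norm (S t)"
  have q: "0 \<le> q" "q < 1"
    using t by (auto simp: q_def norm_w exp_minus field_simps)
  \<comment> \<open>the norm on pairs is not invariant under complex phases; passing to a multiple of \<open>t\<close>
    absorbs the factor \<open>8\<close> in \<open>norm_U\<close>\<close>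
  have Sn: "cmod (w (n * t)) * norm (S (n * t)) \<le> q ^ n * max 1 (norm (S 0))" for n :: nat
  proof (induction n)
    case (Suc n)
    have "w (Suc n * t) = w t * w (n * t)"
      by (simp add: w_def exp_add[symmetric] algebra_simps)
    moreover have "S (Suc n * t) = S t o\<^sub>L S (n * t)"
      using S.C0 t by (simp add: C0_semigroup_def algebra_simps)
    ultimately have "cmod (w (Suc n * t)) * norm (S (Suc n * t))
        \<le> q * (cmod (w (n * t)) * norm (S (n * t)))"
      using mult_left_mono[OF norm_blinfun_compose[of "S t" "S (n * t)"], of "cmod (w t) * cmod (w (n * t))"]
      by (simp add: q_def norm_mult mult_ac)
    also have "\<dots> \<le> q * (q ^ n * max 1 (norm (S 0)))" by (rule mult_left_mono[OF Suc q(1)])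
    finally show ?case by (simp add: mult_ac)
  qed (simp add: w_def)
  have "(\<lambda>n. 8 * (q ^ n * max 1 (norm (S 0)))) \<longlonglongrightarrow> 8 * (0 * max 1 (norm (S 0)))"
    using q by (intro tendsto_intros LIMSEQ_power_zero) simp
  then have "\<forall>\<^sub>F n in sequentially. 8 * (q ^ n * max 1 (norm (S 0))) < 1"
    by (rule order_tendstoD) simp
  then obtain n where n: "8 * (q ^ n * max 1 (norm (S 0))) < 1"
    by (meson eventually_sequentially order_refl)
  define \<tau> where "\<tau> = n * t"
  have \<tau>: "0 \<le> \<tau>" using t by (simp add: \<tau>_def)
  have "norm (U \<tau>) < 1"
    using norm_U[of \<tau>] Sn[of n] n by (simp add: \<tau>_def)
  then obtain N where N: "bounded_linear N" "\<And>z. N z - U \<tau> (N z) = z" "\<And>z. N (z - U \<tau> z) = z"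
    using Neumann_series[of "U \<tau>" "norm (U \<tau>)"] bounded_linear.linear[OF blinfun.bounded_linear_right] norm_blinfun norm_ge_zero by metis
  define R where "R z = U.W \<tau> (N z)" for z
  have W: "bounded_linear (U.W \<tau>)" by (rule U.bounded_linear_W[OF \<tau>])
  have R: "bounded_linear R"
    unfolding R_def by (rule bounded_linear_compose[OF W N(1)])
  have RD: "R z \<in> D \<times> D" for z
    unfolding R_def by (rule U_generator_dom[OF U.W_generator[OF \<tau>]])
  have fR: "?f (R z) = z" for z
  proof -
    have "U \<tau> (N z) - N z = map_prod A A (R z) - cscale \<mu> (R z)"
      using tendsto_unique[OF _ U.W_generator[OF \<tau>, of "N z"] U_generator[OF RD[of z, unfolded R_def]]]
      by (simp add: R_def)
    then have "?f (R z) = N z - U \<tau> (N z)" by (metis minus_diff_eq)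
    then show ?thesis by (simp only: N)
  qed
  \<comment> \<open>This makes \<open>N\<close> after \<open>U.W \<tau>\<close> a left inverse,
    while \<open>R\<close> is \<open>U.W \<tau>\<close> after \<open>N\<close>. Since
    \<open>?f\<close> is injective on \<open>D \<times> D\<close> and \<open>R\<close> is a right
    inverse with values there, \<open>R\<close> is the inverse, without any argument that the two
    factors commute.\<close>
  have Wf: "N (U.W \<tau> (?f z)) = z" if "z \<in> D \<times> D" for z
  proof -
    have "U.W \<tau> (?f z) = - U.W \<tau> (map_prod A A z - cscale \<mu> z)"
      by (metis minus_diff_eq linear_neg[OF bounded_linear.linear[OF W]])
    also have "\<dots> = z - U \<tau> z"
      using U.W_derivative[OF \<tau> U_generator[OF that]] by simp
    finally show ?thesis by (simp only: N)
  qed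
  have b: "bij_betw ?f (D \<times> D) UNIV"
  proof (rule bij_betw_byWitness[where f' = R])
    show "\<forall>z\<in>D \<times> D. R (?f z) = z"
      using Wf RD fR by metis
    show "R ` UNIV \<subseteq> D \<times> D" using RD by blast
  qed (simp_all only: fR, simp_all)
  have "inv_into (D \<times> D) ?f = R"
  proof
    fix z
    have "inv_into (D \<times> D) ?f (?f (R z)) = R z"
      by (rule inv_into_f_f[OF bij_betw_imp_inj_on[OF b] RD])
    then show "inv_into (D \<times> D) ?f z = R z" by (simp only: fR)
  qed
  then show ?thesis using b R by (simp add: resolvent_set_def)
qed

end

theorem spectral_bound_le_growth_bound:
  assumes "locally_bounded_semigroup S" "generates D A S"
  shows "spectral_bound D A \<le> growth_bound S"
  unfolding spectral_bound_def growth_bound_def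
proof (intro SUP_least INF_greatest)
  fix \<mu> t assume \<mu>: "\<mu> \<in> - resolvent_set D A" and t: "t \<in> {0::real<..}"
  interpret complexified_semigroup S D A \<mu>
    by (intro complexified_semigroup.intro complexified_semigroup_axioms.intro assms)
  \<comment> \<open>The contrapositive of \<open>in_resolvent_set\<close>. It also rules out
    \<open>norm (S t) = 0\<close>, the case in which the growth bound would be minus
    infinity.\<close>
  have le: "exp (Re \<mu> * t) \<le> norm (S t)"
    using in_resolvent_set[of t] \<mu> t by force
  then have "0 < norm (S t)" using exp_gt_zero less_le_trans by blast
  moreover from this have "Re \<mu> * t \<le> ln (norm (S t))"
    using le by (simp add: ln_ge_iff)
  ultimately show "ereal (Re \<mu>) \<le> (if norm (S t) = 0 then - \<infinity> else ereal (ln (norm (S t)) / t))"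
    using t by (simp add: pos_le_divide_eq)
qed

lemma growth_bound_le:
  assumes "\<And>t. 0 \<le> t \<Longrightarrow> norm (S t) \<le> K * exp (r * t)"
  shows "growth_bound S \<le> ereal r"
proof (rule ereal_le_epsilon2)
  fix e :: real assume e: "0 < e"
  \<comment> \<open>Large enough that \<open>ln (max 1 K) \<le> e * t\<close>, so the factor
    \<open>K\<close> contributes at most \<open>e\<close> to the exponent; the summand
    \<open>1\<close> keeps \<open>t\<close> positive.\<close>
  define t where "t = ln (max 1 K) / e + 1"
  have t: "0 < t" using e by (simp add: t_def add_nonneg_pos)
  have "growth_bound S \<le> (if norm (S t) = 0 then - \<infinity> else ereal (ln (norm (S t)) / t))"
    unfolding growth_bound_def by (rule INF_lower) (use t in simp)
  also have "\<dots> \<le> ereal (r + e)"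
  proof (cases "norm (S t) = 0")
    case False
    have "norm (S t) \<le> max 1 K * exp (r * t)"
      using assms[of t] t by (intro order_trans[OF assms] mult_right_mono) auto
    then have "ln (norm (S t)) \<le> ln (max 1 K * exp (r * t))"
      using False by (subst ln_le_cancel_iff) (auto simp: less_max_iff_disj)
    also have "\<dots> = ln (max 1 K) + r * t"
      by (subst ln_mult) (auto simp: less_max_iff_disj)
    also have "ln (max 1 K) \<le> e * t"
      using e by (simp add: t_def distrib_left)
    finally have "ln (norm (S t)) \<le> (r + e) * t" by (simp add: algebra_simps)
    then show ?thesis using t False by (simp add: pos_divide_le_eq)
  qed simp
  finally show "growth_bound S \<le> ereal r + ereal e" by simp
qed

section \<open>Resolvent positive operators\<close>

text \<open>For \<open>u\<close> slightly below \<open>v\<close>, \<open>R(u)\<close> is the Neumann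
  series of \<open>(v - u) R(v)\<close> applied after \<open>R(v)\<close>, and all its terms are
  positive. The admissible step depends on the norm of the resolvent, so Bolzano's principle on the
  compact interval links the local steps.\<close>

lemma resolvent_nonneg_downward:
  fixes D :: "'a::banach_lattice set"
  assumes ab: "a \<le> b" and reg: "\<And>r. a \<le> r \<Longrightarrow> r \<le> b \<Longrightarrow> regular D A r"
    and pos: "\<And>x. 0 \<le> x \<Longrightarrow> 0 \<le> resolvent D A b x" and x: "0 \<le> x"
  shows "0 \<le> resolvent D A a x"
proof -
  define pos_at where "pos_at r \<longleftrightarrow> (\<forall>x\<ge>0. 0 \<le> resolvent D A r x)" for r
  \<comment> \<open>The trivial premises put the claim into the form of the Bolzano predicate, which
    confines the subintervals to \<open>{a..b}\<close>, where regularity is known.\<close>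
  have "a \<le> a \<and> b \<le> b \<longrightarrow> pos_at b \<longrightarrow> pos_at a"
    using ab
  proof (induction rule: Bolzano[where P = "\<lambda>u v. a \<le> u \<and> v \<le> b \<longrightarrow> pos_at v \<longrightarrow> pos_at u"])
    case (local s)
    have regs: "regular D A s" using reg local by simp
    obtain C where C: "0 < C" "\<And>z. norm (resolvent D A s z) \<le> norm z * C"
      using bounded_linear.pos_bounded[OF bounded_linear_resolvent[OF regs]] by blast
    \<comment> \<open>On an interval around \<open>s\<close> shorter than
      \<open>1 / (4 * C)\<close>, the bound \<open>C\<close> for \<open>R(s)\<close> gives
      \<open>2 * C\<close> for \<open>R(v)\<close>, and then \<open>(v - u) R(v)\<close> has norm at
      most \<open>1 / 2\<close>.\<close>
    show ?case
    proof (intro exI[of _ "1 / (4 * C)"] conjI allI impI)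
      show "0 < 1 / (4 * C)" using C by simp
      fix u v assume uv: "u \<le> s \<and> s \<le> v \<and> v - u < 1 / (4 * C)" "a \<le> u \<and> v \<le> b" and "pos_at v"
      then have regu: "regular D A u" and regv: "regular D A v"
        and posv: "\<And>x. 0 \<le> x \<Longrightarrow> 0 \<le> resolvent D A v x"
        using reg by (auto simp: pos_at_def)
      have vu: "0 \<le> v - u" "(v - u) * C \<le> 1 / 4" "(v - s) * C \<le> 1 / 4"
      proof -
        show *: "(v - u) * C \<le> 1 / 4" using uv C by (simp add: field_simps)
        have "(v - s) * C \<le> (v - u) * C" using uv C by (intro mult_right_mono) auto
        then show "(v - s) * C \<le> 1 / 4" using * by linarith
      qed (use uv in auto)
      have bound: "norm (resolvent D A v z) \<le> 2 * C * norm z" for z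
      proof -
        let ?w = "resolvent D A v z"
        have "?w = resolvent D A s z - (v - s) *\<^sub>R resolvent D A s ?w"
          using resolvent_identity[OF regs regv, of z] by (simp add: algebra_simps)
        then have "norm ?w \<le> norm (resolvent D A s z) + norm ((v - s) *\<^sub>R resolvent D A s ?w)"
          by (metis norm_triangle_ineq4)
        also have "\<dots> \<le> norm z * C + (v - s) * (norm ?w * C)"
          using uv C by (auto intro!: add_mono mult_left_mono)
        also have "(v - s) * (norm ?w * C) \<le> 1 / 4 * norm ?w"
          using mult_right_mono[OF vu(3), of "norm ?w"] by (simp add: mult_ac)
        finally have "norm ?w \<le> norm z * C + 1 / 4 * norm ?w" by simp
        moreover have "0 \<le> norm z * C" using C by simp
        ultimately show ?thesis by (simp add: mult_ac)
      qed
      define T where "T z = (v - u) *\<^sub>R resolvent D A v z" for z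
      have T: "linear T"
        unfolding T_def[abs_def] by (intro linear_compose_scale_right linear_resolvent regv)
      have Tpos: "0 \<le> T z" if "0 \<le> z" for z
        using vu posv[OF that] by (simp add: T_def scaleR_nonneg_nonneg)
      have Tq: "norm (T z) \<le> 1 / 2 * norm z" for z
      proof -
        have "norm (T z) \<le> (v - u) * (2 * C * norm z)"
          unfolding T_def norm_scaleR using vu bound by (simp add: mult_left_mono)
        also have "\<dots> = 2 * ((v - u) * C) * norm z" by simp
        also have "\<dots> \<le> 2 * (1 / 4) * norm z" using vu by (intro mult_right_mono mult_left_mono) auto
        finally show ?thesis by simp
      qed
      obtain N where N: "\<And>z. N (z - T z) = z" "\<And>z. (\<lambda>k. (T ^^ k) z) sums N z"
        by (rule Neumann_series[OF T _ _ Tq]) (simp, simp, blast)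
      have "0 \<le> resolvent D A u y" if y: "0 \<le> y" for y
      proof -
        let ?w = "resolvent D A u y"
        have "?w - T ?w = resolvent D A v y"
          using resolvent_identity[OF regv regu, of y] by (simp add: T_def algebra_simps)
        then have "?w = N (resolvent D A v y)" using N(1) by metis
        then show ?thesis
          using Neumann_nonneg[OF Tpos N(2) posv[OF y]] by simp
      qed
      then show "pos_at u" by (simp add: pos_at_def)
    qed
  qed auto
  then show ?thesis using pos x by (simp add: pos_at_def)
qed

lemma resolvent_antimono:
  fixes D :: "'a::banach_lattice set"
  assumes "a \<le> b" "regular D A a" "regular D A b"
    and "\<And>x. 0 \<le> x \<Longrightarrow> 0 \<le> resolvent D A a x" "\<And>x. 0 \<le> x \<Longrightarrow> 0 \<le> resolvent D A b x" "0 \<le> x"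
  shows "resolvent D A b x \<le> resolvent D A a x"
proof -
  have "0 \<le> (b - a) *\<^sub>R resolvent D A a (resolvent D A b x)"
    using assms by (intro scaleR_nonneg_nonneg) auto
  then show ?thesis using resolvent_identity[OF assms(2,3), of x] by (metis diff_ge_0_iff_ge)
qed

theorem resolvent_positive_generates:
  fixes D :: "'a::banach_lattice set"
  assumes lin: "linear_operator D A" and dense: "closure D = UNIV"
    and reg: "\<And>s. r \<le> s \<Longrightarrow> regular D A s"
    and pos: "\<And>s x. r \<le> s \<Longrightarrow> 0 \<le> x \<Longrightarrow> 0 \<le> resolvent D A s x"
    and c: "0 < c" "\<And>x. 0 \<le> x \<Longrightarrow> c * norm x \<le> norm (resolvent D A r x)"
  obtains S where "generates D A S" "positive_semigroup S" "locally_bounded_semigroup S"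
proof -
  let ?R = "resolvent D A r"
  have regr: "regular D A r" and posr: "\<And>x. 0 \<le> x \<Longrightarrow> 0 \<le> ?R x"
    using reg pos by auto
  have Rlin: "linear ?R" by (rule linear_resolvent[OF regr])
  have Rmono: "?R x \<le> ?R y" if "x \<le> y" for x y
    by (rule positive_linear_mono[OF Rlin posr that])
  obtain C where C: "\<And>x. norm (?R x) \<le> norm x * C"
    using bounded_linear.bounded[OF bounded_linear_resolvent[OF regr]] by blast
  \<comment> \<open>The shift by \<open>r\<close> moves the half line above \<open>r\<close> to the
    positive reals: \<open>R(s,A') = R(s + r,A)\<close>.\<close>
  define A' where "A' x = A x + (- r) *\<^sub>R x" for x
  \<comment> \<open>The absolute value inside makes the lower estimate, which concerns the cone,
    into a lower bound of \<open>p\<close> on the whole space.\<close>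
  define p where "p x = norm (?R \<bar>x\<bar>)" for x
  have fun_eq: "(\<lambda>x. s *\<^sub>R x - A' x) = (\<lambda>x. (s + r) *\<^sub>R x - A x)" for s
    by (auto simp: A'_def algebra_simps)
  have res: "resolvent D A' s = resolvent D A (s + r)" for s
    unfolding resolvent_def fun_eq ..
  have reg': "regular D A' s \<longleftrightarrow> regular D A (s + r)" for s
    unfolding regular_def res fun_eq ..
  interpret dissipative_operator D A' p c C
  proof
    show "linear_operator D A'"
      using lin unfolding linear_operator_def A'_def by (auto simp: algebra_simps)
    show "closure D = UNIV" by (rule dense)
    fix x y :: 'a and s :: real
    show "p (x + y) \<le> p x + p y"
    proof -
      have "norm (?R \<bar>x + y\<bar>) \<le> norm (?R (\<bar>x\<bar> + \<bar>y\<bar>))"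
        by (intro norm_mono_nonneg posr Rmono abs_triangle_ineq) simp
      also have "\<dots> \<le> norm (?R \<bar>x\<bar>) + norm (?R \<bar>y\<bar>)"
        by (simp add: linear_add[OF Rlin] norm_triangle_ineq)
      finally show ?thesis by (simp add: p_def)
    qed
    show "p (s *\<^sub>R x) = \<bar>s\<bar> * p x"
      by (simp add: p_def abs_scaleR_lattice linear_scale[OF Rlin])
    show "c * norm x \<le> p x" using c(2)[of "\<bar>x\<bar>"] by (simp add: p_def)
    show "p x \<le> C * norm x" using C[of "\<bar>x\<bar>"] by (simp add: p_def mult.commute)
    show "0 < c" by (rule c)
    assume s: "0 < s"
    show "regular D A' s" using reg[of "s + r"] s by (simp add: reg')
    show "s * p (resolvent D A' s x) \<le> p x"
    proof -
      let ?Q = "resolvent D A (s + r)"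
      have regs: "regular D A (s + r)" and posQ: "\<And>x. 0 \<le> x \<Longrightarrow> 0 \<le> ?Q x"
        using reg pos s by auto
      have "?R \<bar>?Q x\<bar> \<le> ?R (?Q \<bar>x\<bar>)"
        by (intro Rmono positive_linear_abs_le linear_resolvent regs posQ)
      then have "s *\<^sub>R ?R \<bar>?Q x\<bar> \<le> s *\<^sub>R ?R (?Q \<bar>x\<bar>)"
        using s by (intro scaleR_left_mono) auto
      also have "\<dots> = ?R \<bar>x\<bar> - ?Q \<bar>x\<bar>"
        using resolvent_identity[OF regr regs, of "\<bar>x\<bar>"] by simp
      also have "\<dots> \<le> ?R \<bar>x\<bar>" using posQ[of "\<bar>x\<bar>"] by simp
      finally have "norm (s *\<^sub>R ?R \<bar>?Q x\<bar>) \<le> norm (?R \<bar>x\<bar>)"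
        using s by (intro norm_mono_nonneg scaleR_nonneg_nonneg posr) auto
      then show ?thesis using s by (simp add: res p_def)
    qed
  qed
  obtain S where S: "generates D A' S"
    and Sp: "\<And>t x. 0 \<le> t \<Longrightarrow> p (blinfun_apply (S t) x) \<le> p x"
    and inv: "\<And>Z t x. closed Z \<Longrightarrow> (\<And>s x. 0 < s \<Longrightarrow> x \<in> Z \<Longrightarrow> s *\<^sub>R resolvent D A' s x \<in> Z) \<Longrightarrow>
      0 \<le> t \<Longrightarrow> x \<in> Z \<Longrightarrow> blinfun_apply (S t) x \<in> Z"
    using generates_contraction_semigroup by blast
  let ?V = "\<lambda>t. exp (r * t) *\<^sub>R S t"
  have "generates D (\<lambda>x. A' x + r *\<^sub>R x) ?V" by (rule generates_rescale[OF S])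
  then have gen: "generates D A ?V" by (simp add: A'_def)
  have "0 \<le> blinfun_apply (S t) x" if "0 \<le> t" "0 \<le> x" for t x
  proof -
    have "s *\<^sub>R resolvent D A' s y \<in> {0..}" if "0 < s" "y \<in> {0..}" for s y
      using that pos[of "s + r" y] by (simp add: res scaleR_nonneg_nonneg)
    from inv[OF closed_nonneg_cone this that(1), of x] show ?thesis using that by simp
  qed
  then have pos: "positive_semigroup ?V"
    by (auto simp: positive_semigroup_def blinfun.scaleR_left intro!: scaleR_nonneg_nonneg)
  have bnd: "norm (?V t) \<le> exp (\<bar>r\<bar> * b) * (\<bar>C\<bar> / c)" if "t \<in> {0..b}" for t b
  proof -
    have "norm (S t) \<le> \<bar>C\<bar> / c"
    proof (rule norm_blinfun_bound)
      fix x
      have "c * norm (S t x) \<le> C * norm x"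
        using p_lower Sp p_upper that by (meson atLeastAtMost_iff order_trans)
      also have "\<dots> \<le> \<bar>C\<bar> * norm x" by (intro mult_right_mono) auto
      finally show "norm (S t x) \<le> \<bar>C\<bar> / c * norm x"
        using c by (simp add: field_simps)
    qed (use c in simp)
    moreover have "r * t \<le> \<bar>r\<bar> * b" using that by (intro mult_mono) auto
    ultimately have "exp (r * t) * norm (S t) \<le> exp (\<bar>r\<bar> * b) * (\<bar>C\<bar> / c)"
      by (intro mult_mono) auto
    then show ?thesis by simp
  qed
  have "locally_bounded_semigroup ?V"
  proof
    show "C0_semigroup ?V" using gen by (simp add: generates_def)
    show "\<exists>K. \<forall>t\<in>{0..b}. norm (?V t) \<le> K" for b using bnd by blast
  qed
  with gen pos show ?thesis by (rule that)
qed

text \<open>The generator \<open>A - r\<close> of \<open>V\<close> sends \<open>R(r) x\<close> to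
  \<open>- x\<close>, so \<open>R(r) x - V t (R(r) x)\<close> is the orbit integral of
  \<open>x\<close> and is nonnegative for \<open>0 \<le> x\<close>. As \<open>V t\<close> commutes
  with \<open>R(r)\<close>, this says \<open>R(r) (V t x) \<le> R(r) x\<close>, and the lower
  estimate bounds \<open>V t\<close> uniformly in \<open>t\<close>.\<close>

lemma positive_semigroup_growth:
  fixes D :: "'a::banach_lattice set"
  assumes gen: "generates D A S" and Spos: "positive_semigroup S"
    and bdd: "locally_bounded_semigroup S" and reg: "regular D A r"
    and pos: "\<And>x. 0 \<le> x \<Longrightarrow> 0 \<le> resolvent D A r x"
    and c: "0 < c" "\<And>x. 0 \<le> x \<Longrightarrow> c * norm x \<le> norm (resolvent D A r x)"
  shows "growth_bound S \<le> ereal r"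
proof -
  interpret S: locally_bounded_semigroup S by (rule bdd)
  let ?R = "resolvent D A r"
  define V where "V t = exp (- r * t) *\<^sub>R S t" for t
  have genV: "generates D (\<lambda>x. A x + (- r) *\<^sub>R x) V"
    unfolding V_def by (rule generates_rescale[OF gen])
  have "\<exists>K. \<forall>t\<in>{0..b}. norm (V t) \<le> K" for b
  proof -
    obtain K where K: "\<And>t. t \<in> {0..b} \<Longrightarrow> norm (S t) \<le> K"
      using S.locally_bounded by blast
    have "norm (V t) \<le> exp (\<bar>r\<bar> * b) * K" if "t \<in> {0..b}" for t
    proof -
      have "- r * t \<le> \<bar>r\<bar> * b" using that by (intro mult_mono) auto
      then show ?thesis using K[OF that] by (auto simp: V_def intro: mult_mono)
    qed
    then show ?thesis by blast
  qed
  then interpret V: locally_bounded_semigroup V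
    using genV by unfold_locales (simp_all add: generates_def)
  have Vpos: "0 \<le> V t x" if "0 \<le> t" "0 \<le> x" for t x
    using Spos that by (simp add: V_def positive_semigroup_def blinfun.scaleR_left scaleR_nonneg_nonneg)
  obtain C where C: "\<And>x. norm (?R x) \<le> norm x * C"
    using bounded_linear.bounded[OF bounded_linear_resolvent[OF reg]] by blast
  have decay: "norm (V t x) \<le> \<bar>C\<bar> / c * norm x" if t: "0 \<le> t" for t x
  proof (rule positive_linear_norm_le)
    show "linear (V t)" by (rule bounded_linear.linear[OF blinfun.bounded_linear_right])
    show "0 \<le> V t x" if "0 \<le> x" for x by (rule Vpos[OF t that])
    fix x :: 'a assume x: "0 \<le> x"
    interpret W: bounded_linear "V.W t" by (rule V.bounded_linear_W[OF t])
    have "V.W t (- x) = V t (?R x) - ?R x"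
      using V.W_derivative[OF t generates_derivative[OF genV resolvent_in_dom[OF reg]], of x]
      by (simp add: op_resolvent[OF reg])
    moreover have "0 \<le> V.W t x"
      unfolding V.W_def by (intro integral_nonneg_lattice V.integrable_orbit Vpos x) auto
    moreover have "V.W t (- x) = - V.W t x" by (rule W.neg)
    ultimately have "V t (?R x) - ?R x \<le> 0" by (metis neg_le_0_iff_le)
    then have "V t (?R x) \<le> ?R x" by simp
    moreover have "V t (?R x) = ?R (V t x)"
      unfolding V_def
      by (simp add: blinfun.scaleR_left generates_resolvent_commute[OF gen t reg]
          linear_scale[OF linear_resolvent[OF reg]])
    ultimately have "norm (?R (V t x)) \<le> norm (?R x)"
      by (intro norm_mono_nonneg pos Vpos t x) simp
    then have "c * norm (V t x) \<le> norm x * C"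
      using c(2)[OF Vpos[OF t x]] C[of x] by linarith
    also have "\<dots> \<le> norm x * \<bar>C\<bar>" by (intro mult_left_mono) auto
    finally show "norm (V t x) \<le> \<bar>C\<bar> / c * norm x" using c by (simp add: field_simps)
  qed
  show ?thesis
  proof (rule growth_bound_le)
    fix t :: real assume t: "0 \<le> t"
    have "norm (V t) \<le> \<bar>C\<bar> / c"
      by (rule norm_blinfun_bound) (use decay[OF t] c in auto)
    then have "exp (r * t) * norm (V t) \<le> exp (r * t) * (\<bar>C\<bar> / c)"
      by (intro mult_left_mono) auto
    moreover have "norm (S t) = exp (r * t) * norm (V t)"
      by (simp add: V_def exp_minus)
    ultimately show "norm (S t) \<le> \<bar>C\<bar> / c * exp (r * t)" by (simp add: mult.commute)
  qed
qed

theorem positive_semigroup_spectral_bound: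
  fixes D :: "'a::banach_lattice set"
  assumes gen: "generates D A S" and Spos: "positive_semigroup S"
    and bdd: "locally_bounded_semigroup S"
    and reg: "regular D A r"
    and pos: "\<And>x. 0 \<le> x \<Longrightarrow> 0 \<le> resolvent D A r x"
    and c: "0 < c" "\<And>x. 0 \<le> x \<Longrightarrow> c * norm x \<le> norm (resolvent D A r x)"
  shows "spectral_bound D A = growth_bound S"
proof (rule antisym[OF spectral_bound_le_growth_bound[OF bdd gen]])
  show "growth_bound S \<le> spectral_bound D A"
  proof (rule ccontr)
    assume "\<not> ?thesis"
    then obtain q where q: "spectral_bound D A < ereal q" "ereal q < growth_bound S"
      by (meson ereal_dense2 not_le)
    have regq: "regular D A s" if "q \<le> s" for s
    proof (rule resolvent_set_imp_regular, rule ccontr)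
      assume "complex_of_real s \<notin> resolvent_set D A"
      then have "ereal s \<le> spectral_bound D A"
        unfolding spectral_bound_def by (intro SUP_upper2[of "complex_of_real s"]) auto
      also have "\<dots> < ereal q" by (rule q)
      finally show False using that by simp
    qed
    have gr: "growth_bound S \<le> ereal r"
      by (rule positive_semigroup_growth[OF gen Spos bdd reg pos c])
    \<comment> \<open>If \<open>r \<le> q\<close>, the bound \<open>gr\<close> already contradicts
      the choice of \<open>q\<close>. Otherwise positivity and the lower estimate are carried down
      from \<open>r\<close> to \<open>q\<close>, past no real spectrum.\<close>
    show False
    proof (cases "r \<le> q")
      case True
      then show False using gr q(2) by (meson ereal_less_eq(3) not_le order_trans)
    next
      case False
      then have qr: "q \<le> r" by simp
      have posq: "0 \<le> resolvent D A q x" if "0 \<le> x" for x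
        by (rule resolvent_nonneg_downward[OF qr regq pos that])
      have "c * norm x \<le> norm (resolvent D A q x)" if x: "0 \<le> x" for x
      proof -
        have "c * norm x \<le> norm (resolvent D A r x)" by (rule c(2)[OF x])
        \<comment> \<open>Resolvents decrease on the cone as the point increases, so the constant
          \<open>c\<close> remains valid at \<open>q\<close>.\<close>
        also have "\<dots> \<le> norm (resolvent D A q x)"
          by (intro norm_mono_nonneg pos resolvent_antimono regq reg posq qr x) auto
        finally show ?thesis .
      qed
      then have "growth_bound S \<le> ereal q"
        by (intro positive_semigroup_growth[OF gen Spos bdd regq posq c(1)]) auto
      then show False using q(2) by simp
    qed
  qed
qed

section \<open>Extrapolation and perturbation\<close>

text \<open>On the dense range of \<open>J\<close> the assignment
  \<open>J x \<mapsto> R(m) x\<close> is isometric and extends to all of \<open>'b\<close>. It is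
  onto because its image contains limits of sequences from the dense set \<open>D\<close>: by
  isometry their preimages are Cauchy. Thus \<open>'b\<close> is a copy of the original space in
  which \<open>J\<close> becomes \<open>R(m)\<close>.\<close>

lemma extrapolation_isometry:
  fixes D :: "'a::banach set" and J :: "'a \<Rightarrow> 'b::banach"
  assumes dense: "closure D = UNIV" and ext: "extrapolation_space D A J"
  obtains m Q where "regular D A m" "bounded_linear Q" "\<And>x. Q (J x) = resolvent D A m x"
    "\<And>y. norm (Q y) = norm y" "surj Q"
proof -
  obtain m where m: "complex_of_real m \<in> resolvent_set D A"
    and norm_J: "\<And>x. norm (J x) = norm (resolvent D A m x)"
    and J: "linear J" and J_dense: "closure (range J) = UNIV"
    using ext unfolding extrapolation_space_def by auto
  let ?R = "resolvent D A m"
  have reg: "regular D A m" by (rule resolvent_set_imp_regular[OF m])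
  have R: "linear ?R" by (rule linear_resolvent[OF reg])
  have iso: "dist (?R x) (?R y) = dist (J x) (J y)" for x y
    using norm_J[of "x - y"] by (simp add: dist_norm linear_diff[OF R] linear_diff[OF J])
  have JJ: "J (inv J (J x)) = J x" for x by (rule f_inv_into_f) simp
  \<comment> \<open>\<open>inv J\<close> picks some preimage; by isometry all preimages of a point
    have the same image under \<open>?R\<close>.\<close>
  have J_inv: "?R (inv J (J x)) = ?R x" for x
    using JJ iso[of "inv J (J x)" x] by simp
  have "uniformly_continuous_on (range J) (\<lambda>y. ?R (inv J y))"
    unfolding uniformly_continuous_on_def by (auto simp: JJ iso)
  then obtain Q where Q: "uniformly_continuous_on UNIV Q" "\<And>y. y \<in> range J \<Longrightarrow> ?R (inv J y) = Q y"
    by (rule uniformly_continuous_on_extension_on_closure) (auto simp: J_dense)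
  have QJ: "Q (J x) = ?R x" for x using Q(2)[of "J x"] J_inv[of x] by simp
  have lim: "(\<lambda>n. ?R (u n)) \<longlonglongrightarrow> Q y" if "(\<lambda>n. J (u n)) \<longlonglongrightarrow> y" for u :: "nat \<Rightarrow> 'a" and y
    using continuous_on_tendsto_compose[OF uniformly_continuous_imp_continuous[OF Q(1)] that]
    by (simp add: QJ)
  have approx: "\<exists>u. (\<lambda>n. J (u n)) \<longlonglongrightarrow> y" for y
  proof -
    have "y \<in> closure (range J)" by (simp add: J_dense)
    then obtain f where f: "\<And>n. f n \<in> range J" "f \<longlonglongrightarrow> y"
      unfolding closure_sequential by blast
    have "(\<lambda>n. J (inv J (f n))) = f" using f(1) by (auto simp: f_inv_into_f)
    then show ?thesis using f(2) by metis
  qed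
  have normQ: "norm (Q y) = norm y" for y
  proof -
    obtain u where u: "(\<lambda>n. J (u n)) \<longlonglongrightarrow> y" using approx by blast
    show ?thesis
      using LIMSEQ_unique[OF tendsto_norm[OF lim[OF u]]] tendsto_norm[OF u] by (simp add: norm_J)
  qed
  have blQ: "bounded_linear Q"
  proof (rule bounded_linear_intro[of _ 1])
    fix x y r
    obtain u where u: "(\<lambda>n. J (u n)) \<longlonglongrightarrow> x" using approx by blast
    obtain v where v: "(\<lambda>n. J (v n)) \<longlonglongrightarrow> y" using approx by blast
    have "(\<lambda>n. J (u n + v n)) \<longlonglongrightarrow> x + y"
      using tendsto_add[OF u v] by (simp add: linear_add[OF J])
    from lim[OF this] show "Q (x + y) = Q x + Q y"
      using LIMSEQ_unique tendsto_add[OF lim[OF u] lim[OF v]] by (simp add: linear_add[OF R]) blast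
    have "(\<lambda>n. J (r *\<^sub>R u n)) \<longlonglongrightarrow> r *\<^sub>R x"
      using tendsto_scaleR[OF tendsto_const u] by (simp add: linear_scale[OF J])
    from lim[OF this] show "Q (r *\<^sub>R x) = r *\<^sub>R Q x"
      using LIMSEQ_unique tendsto_scaleR[OF tendsto_const lim[OF u]] by (simp add: linear_scale[OF R]) blast
  qed (simp add: normQ)
  have "\<exists>z. y = Q z" for y
  proof -
    have "y \<in> closure D" by (simp add: dense)
    then obtain d where d: "\<And>n. d n \<in> D" "d \<longlonglongrightarrow> y" unfolding closure_sequential by blast
    define u where "u n = m *\<^sub>R d n - A (d n)" for n
    have Ru: "(\<lambda>n. ?R (u n)) = d" unfolding u_def by (auto simp: resolvent_left[OF reg d(1)])
    have "Cauchy (\<lambda>n. ?R (u n))" unfolding Ru by (rule LIMSEQ_imp_Cauchy[OF d(2)])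
    then have "Cauchy (\<lambda>n. J (u n))" unfolding Cauchy_def iso .
    then obtain z where "(\<lambda>n. J (u n)) \<longlonglongrightarrow> z" using Cauchy_convergent convergent_def by blast
    from lim[OF this] have "y = Q z" unfolding Ru by (rule LIMSEQ_unique[OF d(2)])
    then show ?thesis ..
  qed
  then have "surj Q" by (simp add: surj_def)
  with reg blQ QJ normQ show ?thesis by (rule that)
qed

text \<open>\<open>extrapolated_semigroup\<close> is a choice, so a witness has to be exhibited: the
  conjugate of \<open>T t\<close> by \<open>Q\<close>. For whatever semigroup is chosen, the orbits
  of \<open>J x\<close> are prescribed, and \<open>Q\<close> carries their difference quotients to
  those of \<open>R(m) x\<close>, which lies in \<open>D\<close>.\<close>

lemma extrapolated_op_apply:
  fixes D :: "'a::banach set" and J :: "'a \<Rightarrow> 'b::banach"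
  assumes gen: "generates D A T\<^sub>0" and m: "regular D A m"
    and Q: "bounded_linear Q" and QJ: "\<And>x. Q (J x) = resolvent D A m x"
    and normQ: "\<And>y. norm (Q y) = norm y" and surjQ: "surj Q"
  shows "Q (extrapolated_op D A J (J x)) = m *\<^sub>R resolvent D A m x - x"
proof -
  interpret Q: bounded_linear Q by (rule Q)
  let ?R = "resolvent D A m"
  define T where "T = semigroup_of D A"
  have T: "generates D A T"
    unfolding T_def semigroup_of_def by (rule someI[of _ T\<^sub>0]) (rule gen)
  have C0T: "C0_semigroup T" using T by (simp add: generates_def)
  have inj: "inj Q"
    using normQ by (auto simp: inj_on_def) (metis Q.diff norm_eq_zero right_minus_eq)
  have Qi: "Q (inv Q y) = y" "inv Q (Q z) = z" for y z
    using surjQ inj by (auto simp: surj_f_inv_f)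
  have blQi: "bounded_linear (inv Q)"
  proof (rule bounded_linear_intro[of _ 1])
    show "inv Q (x + y) = inv Q x + inv Q y" for x y
      by (rule injD[OF inj]) (simp add: Q.add Qi)
    show "inv Q (r *\<^sub>R x) = r *\<^sub>R inv Q x" for r x
      by (rule injD[OF inj]) (simp add: Q.scaleR Qi)
    show "norm (inv Q x) \<le> norm x * 1" for x
      using normQ[of "inv Q x"] by (simp add: Qi)
  qed
  define E' where "E' t = Blinfun (\<lambda>y. inv Q (T t (Q y)))" for t
  have E'_apply: "blinfun_apply (E' t) y = inv Q (T t (Q y))" for t y
    unfolding E'_def
    by (simp add: bounded_linear_Blinfun_apply bounded_linear_compose[OF blQi]
        bounded_linear_compose[OF blinfun.bounded_linear_right Q])
  have "C0_semigroup E'"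
    unfolding C0_semigroup_def
  proof (intro conjI allI impI)
    show "E' 0 = id_blinfun"
      using C0T by (intro blinfun_eqI) (simp add: E'_apply C0_semigroup_def Qi)
    show "E' (s + t) = E' s o\<^sub>L E' t" if "0 \<le> s" "0 \<le> t" for s t
      using C0T that by (intro blinfun_eqI) (simp add: E'_apply C0_semigroup_def Qi)
    have "((\<lambda>t. T t (Q y)) \<longlongrightarrow> Q y) (at_right 0)" for y
      using C0T by (simp add: C0_semigroup_def)
    from bounded_linear.tendsto[OF blQi this]
    show "((\<lambda>t. blinfun_apply (E' t) y) \<longlongrightarrow> y) (at_right 0)" for y
      by (simp add: E'_apply Qi)
  qed
  moreover have "blinfun_apply (E' t) (J x) = J (T t x)" if "0 \<le> t" for t x
    by (rule injD[OF inj])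
      (simp add: E'_apply Qi QJ generates_resolvent_commute[OF T that m])
  ultimately have ex: "\<exists>E::real \<Rightarrow> 'b \<Rightarrow>\<^sub>L 'b. C0_semigroup E \<and>
      (\<forall>t\<ge>0. \<forall>x. blinfun_apply (E t) (J x) = J (T t x))"
    by (intro exI[of _ E']) simp
  define E where "E = extrapolated_semigroup D A J"
  have "C0_semigroup E \<and> (\<forall>t\<ge>0. \<forall>x. blinfun_apply (E t) (J x) = J (T t x))"
    unfolding E_def extrapolated_semigroup_def T_def[symmetric] by (rule someI_ex[OF ex])
  then have E: "\<And>t x. 0 \<le> t \<Longrightarrow> blinfun_apply (E t) (J x) = J (T t x)" by simp
  let ?l = "m *\<^sub>R ?R x - x"
  have "((\<lambda>t. inv Q ((T t (?R x) - ?R x) /\<^sub>R t)) \<longlongrightarrow> inv Q (A (?R x))) (at_right 0)"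
    by (intro bounded_linear.tendsto[OF blQi] generates_derivative[OF T] resolvent_in_dom[OF m])
  moreover have "\<forall>\<^sub>F t in at_right 0. inv Q ((T t (?R x) - ?R x) /\<^sub>R t) = (E t (J x) - J x) /\<^sub>R t"
    unfolding eventually_at_right_field
  proof (intro exI[of _ 1] conjI allI impI)
    fix t :: real assume t: "0 < t"
    then have "Q ((E t (J x) - J x) /\<^sub>R t) = (T t (?R x) - ?R x) /\<^sub>R t"
      by (simp add: Q.scaleR Q.diff E QJ generates_resolvent_commute[OF T _ m])
    then show "inv Q ((T t (?R x) - ?R x) /\<^sub>R t) = (E t (J x) - J x) /\<^sub>R t"
      by (metis Qi(2))
  qed simp
  ultimately have "((\<lambda>t. (E t (J x) - J x) /\<^sub>R t) \<longlongrightarrow> inv Q (A (?R x))) (at_right 0)"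
    by (rule Lim_transform_eventually)
  then have "extrapolated_op D A J (J x) = inv Q (A (?R x))"
    unfolding extrapolated_op_def gen_op_def E_def by (intro tendsto_Lim) simp
  then show ?thesis by (simp add: Qi op_resolvent[OF m])
qed

text \<open>\<open>P\<close> is the resolvent of the extrapolated operator at \<open>l\<close>,
  regarded as a map into the original space. The point \<open>m\<close> is dictated by the norm on
  \<open>'b\<close>, whereas large values of \<open>l\<close> are wanted, so \<open>P\<close> is
  obtained from \<open>Q\<close> by a change of point.\<close>

lemma extrapolated_resolvent:
  fixes D :: "'a::banach set" and J :: "'a \<Rightarrow> 'b::banach"
  assumes dense: "closure D = UNIV" and ext: "extrapolation_space D A J"
    and gen: "generates D A T\<^sub>0" and l: "regular D A l"
  obtains P where "bounded_linear P" "inj P" "\<And>x. P (J x) = resolvent D A l x"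
    "\<And>x. P (extrapolated_op D A J (J x)) = l *\<^sub>R resolvent D A l x - x"
proof -
  obtain m Q where m: "regular D A m" and Q: "bounded_linear Q" and QJ: "\<And>x. Q (J x) = resolvent D A m x"
    and normQ: "\<And>y. norm (Q y) = norm y" and surjQ: "surj Q"
    using extrapolation_isometry[OF dense ext] by metis
  interpret Q: bounded_linear Q by (rule Q)
  let ?R = "resolvent D A l"
  note Rlin = linear_resolvent[OF l]
  \<comment> \<open>the resolvent identity \<open>R(l) = R(m) + (m - l) R(l) R(m)\<close>, extended to \<open>X\<^sub>-\<^sub>1\<close>\<close>
  define P where "P y = Q y + (m - l) *\<^sub>R ?R (Q y)" for y
  have P: "bounded_linear P"
    unfolding P_def[abs_def]
    by (intro bounded_linear_add Q bounded_linear_const_scaleR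
        bounded_linear_compose[OF bounded_linear_resolvent[OF l] Q])
  have "P y = 0 \<Longrightarrow> y = 0" for y
  proof -
    assume "P y = 0"
    then have Qy: "Q y = (l - m) *\<^sub>R ?R (Q y)" by (simp add: P_def algebra_simps eq_neg_iff_add_eq_0)
    have "Q y = 0"
    proof (cases "l = m")
      case False
      \<comment> \<open>If \<open>P y = 0\<close>, this vector satisfies
        \<open>A ?v = m *\<^sub>R ?v\<close>, and regularity at \<open>m\<close> forces it to
        vanish.\<close>
      let ?v = "?R (Q y)"
      have "l *\<^sub>R v - z = m *\<^sub>R v" if "z = (l - m) *\<^sub>R v" for v z :: 'a
        using that by (simp add: algebra_simps)
      from this[OF Qy] have "A ?v = m *\<^sub>R ?v" by (simp only: op_resolvent[OF l])
      then have "?v = resolvent D A m 0"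
        using resolvent_left[OF m resolvent_in_dom[OF l, of "Q y"]] by simp
      then have "?v = 0" using linear_0[OF linear_resolvent[OF m]] by simp
      then show ?thesis using Qy by simp
    qed (use Qy in simp)
    then show "y = 0" using normQ[of y] by simp
  qed
  then have inj: "inj P"
    using linear_injective_0[OF bounded_linear.linear[OF P]] by blast
  have PJ: "P (J x) = ?R x" for x
    using resolvent_identity[OF l m, of x] by (simp add: P_def QJ algebra_simps)
  have "P (extrapolated_op D A J (J x)) = l *\<^sub>R ?R x - x" for x
  proof -
    have e: "Q (extrapolated_op D A J (J x)) = m *\<^sub>R resolvent D A m x - x"
      by (rule extrapolated_op_apply[OF gen m Q QJ normQ surjQ])
    have "m *\<^sub>R (?R x - resolvent D A m x) = (m - l) *\<^sub>R ?R (m *\<^sub>R resolvent D A m x)"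
      using resolvent_identity[OF l m, of x] by (simp add: linear_scale[OF Rlin])
    then show ?thesis
      unfolding P_def e linear_diff[OF Rlin] by (simp add: algebra_simps)
  qed
  with P inj PJ show ?thesis by (rule that)
qed

theorem theorem2p2:
  fixes D :: "'a::banach_lattice set" and A :: "'a \<Rightarrow> 'a"
    and J :: "'a \<Rightarrow> 'b::banach" and B :: "'a \<Rightarrow>\<^sub>L 'b" and \<mu>\<^sub>0 :: real
  defines "K \<equiv> \<lambda>x. extrapolated_op D A J (J x) + blinfun_apply B x"
  assumes "linear_operator D A" and "closure D = UNIV" and "resolvent_positive D A"
    and "spectral_bound D A < ereal \<mu>\<^sub>0"
    and "\<And>\<mu>. \<mu> \<ge> \<mu>\<^sub>0 \<Longrightarrow> \<exists>c>0. \<forall>x\<ge>0. norm (resolvent D A \<mu> x) \<ge> c * norm x"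
    and "extrapolation_space D A J"
    and "\<And>x. 0 \<le> x \<Longrightarrow> blinfun_apply B x \<in> extrapolated_cone J"
  shows "\<exists>S. generates (part_dom J K) (part_op J K) S \<and> positive_semigroup S \<and>
           spectral_bound (part_dom J K) (part_op J K) = growth_bound S"
proof -
  note lin = \<open>linear_operator D A\<close> and dense = \<open>closure D = UNIV\<close> and ext = \<open>extrapolation_space D A J\<close>
  obtain \<omega> where "\<forall>r>\<omega>. complex_of_real r \<in> resolvent_set D A \<and> (\<forall>x\<ge>0. 0 \<le> resolvent D A r x)"
    using \<open>resolvent_positive D A\<close> unfolding resolvent_positive_def ..
  then have \<omega>: "\<And>r. \<omega> < r \<Longrightarrow> complex_of_real r \<in> resolvent_set D A"
    "\<And>r x. \<omega> < r \<Longrightarrow> 0 \<le> x \<Longrightarrow> 0 \<le> resolvent D A r x"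
    by simp_all
  \<comment> \<open>At and above \<open>r\<close> both the positivity of the resolvent, which holds
    strictly above \<open>\<omega>\<close>, and the lower estimate are available.\<close>
  define r where "r = max \<mu>\<^sub>0 (\<omega> + 1)"
  have r: "\<omega> < r" "\<mu>\<^sub>0 \<le> r" by (auto simp: r_def)
  have reg: "regular D A s" if "r \<le> s" for s
    using that r by (intro resolvent_set_imp_regular \<omega>) simp
  have pos: "0 \<le> resolvent D A s x" if "r \<le> s" "0 \<le> x" for s x
    using that r by (intro \<omega>) auto
  obtain c where c: "0 < c" "\<And>x. 0 \<le> x \<Longrightarrow> c * norm x \<le> norm (resolvent D A r x)"
    using assms(6)[OF r(2)] by auto
  obtain T\<^sub>0 where gen: "generates D A T\<^sub>0"
    using resolvent_positive_generates[OF lin dense reg pos c] by blast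
  have J: "linear J" using ext by (simp add: extrapolation_space_def)
  obtain P\<^sub>0 where P0: "bounded_linear P\<^sub>0" "\<And>x. P\<^sub>0 (J x) = resolvent D A r x"
    using extrapolated_resolvent[OF dense ext gen reg[OF order_refl]] by metis
  obtain C where C: "0 < C" "\<And>y. norm (P\<^sub>0 y) \<le> norm y * C"
    using bounded_linear.pos_bounded[OF P0(1)] by blast
  \<comment> \<open>Chosen so that \<open>C * norm B \<le> c * (l - r) / 2\<close> for
    \<open>s \<le> l\<close>, which makes the norm of \<open>T\<close> below at most
    \<open>1 / 2\<close>; the summand \<open>1\<close> ensures \<open>r < s\<close> even for
    \<open>B = 0\<close>.\<close>
  define s where "s = r + 1 + 2 * C * norm B / c"
  have rs: "r < s" using C c by (auto simp: s_def intro: add_pos_nonneg)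
  let ?D = "part_dom J K" and ?A = "part_op J K"
  have main: "\<exists>N. bounded_linear N \<and> (\<forall>x\<ge>0. x \<le> N x) \<and> surj N \<and> (\<forall>x. N (resolvent D A l x) \<in> ?D)
      \<and> regular ?D ?A l \<and> resolvent ?D ?A l = (\<lambda>x. N (resolvent D A l x)) \<and> linear_operator ?D ?A"
    if "s \<le> l" for l
  proof -
    have rl: "r < l" "r \<le> l" using rs that by auto
    have regr: "regular D A r" and regl: "regular D A l" using reg rl by auto
    let ?R = "resolvent D A l"
    note Rlin = linear_resolvent[OF regl]
    obtain P where P: "bounded_linear P" "inj P" "\<And>x. P (J x) = ?R x"
      "\<And>x. P (extrapolated_op D A J (J x)) = l *\<^sub>R ?R x - x"
      using extrapolated_resolvent[OF dense ext gen regl] by metis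
    interpret P: bounded_linear P by (rule P)
    \<comment> \<open>Both conditions on \<open>y\<close> are closed, so it suffices to check them
      at \<open>J x\<close> with \<open>0 \<le> x\<close>. There \<open>P\<close> and
      \<open>P\<^sub>0\<close> are the resolvents at \<open>l\<close> and \<open>r\<close>, and the
      norm condition follows from \<open>(l - r) R(r) R(l) x \<le> R(r) x\<close> after cancelling
      \<open>R(r)\<close>.\<close>
    have cone: "0 \<le> P y \<and> c * (l - r) * norm (P y) \<le> norm (P\<^sub>0 y)" if "y \<in> extrapolated_cone J" for y
    proof -
      let ?Z = "P -` {0..} \<inter> {y. c * (l - r) * norm (P y) \<le> norm (P\<^sub>0 y)}"
      have contP: "continuous_on UNIV P" and contP0: "continuous_on UNIV P\<^sub>0"
        using P(1) P0(1) by (simp_all add: linear_continuous_on)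
      have "closed ?Z"
      proof (rule closed_Int)
        show "closed (P -` {0..})"
          using closed_vimage[OF closed_nonneg_cone contP] .
        show "closed {y. c * (l - r) * norm (P y) \<le> norm (P\<^sub>0 y)}"
          by (intro closed_Collect_le continuous_intros contP contP0)
      qed
      moreover have "J ` {0..} \<subseteq> ?Z"
      proof (rule image_subsetI)
        fix x :: 'a assume "x \<in> {0..}"
        then have x: "0 \<le> x" by simp
        have Rx: "0 \<le> ?R x" using pos rl x by auto
        have "(l - r) *\<^sub>R resolvent D A r (?R x) \<le> resolvent D A r x"
          unfolding resolvent_identity[OF regr regl, symmetric] using Rx by simp
        then have "norm ((l - r) *\<^sub>R resolvent D A r (?R x)) \<le> norm (resolvent D A r x)"
          using rl Rx pos by (intro norm_mono_nonneg scaleR_nonneg_nonneg) auto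
        then have "(l - r) * norm (resolvent D A r (?R x)) \<le> norm (resolvent D A r x)"
          using rl by simp
        moreover have "(l - r) * (c * norm (?R x)) \<le> (l - r) * norm (resolvent D A r (?R x))"
          using rl by (intro mult_left_mono c Rx) auto
        ultimately have "c * (l - r) * norm (?R x) \<le> norm (resolvent D A r x)"
          by (simp add: mult_ac)
        then show "J x \<in> ?Z" using Rx by (simp add: P P0)
      qed
      ultimately have "closure (J ` {0..}) \<subseteq> ?Z" by (rule closure_minimal[rotated])
      then show ?thesis using that unfolding extrapolated_cone_def by blast
    qed
    define T where "T x = P (B x)" for x
    have T: "linear T"
      unfolding T_def[abs_def]
      by (rule bounded_linear.linear[OF bounded_linear_compose[OF P(1) blinfun.bounded_linear_right]])
    have Tpos: "0 \<le> T x" if "0 \<le> x" for x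
      unfolding T_def using cone assms(8)[OF that] by blast
    have Tq: "norm (T x) \<le> 1 / 2 * norm x" for x
    proof (rule positive_linear_norm_le[OF T Tpos])
      fix x :: 'a assume x: "0 \<le> x"
      have "c * (l - r) * norm (T x) \<le> norm (P\<^sub>0 (B x))"
        unfolding T_def using cone assms(8)[OF x] by blast
      also have "\<dots> \<le> norm (B x) * C" by (rule C)
      also have "\<dots> \<le> norm B * norm x * C" using C by (intro mult_right_mono norm_blinfun) auto
      also have "\<dots> = 1 / 2 * (2 * C * norm B) * norm x" by simp
      also have "\<dots> \<le> 1 / 2 * (c * (l - r)) * norm x"
      proof -
        have "2 * C * norm B / c \<le> l - r" using that by (simp add: s_def)
        then have "2 * C * norm B \<le> c * (l - r)" using c by (simp add: pos_divide_le_eq mult.commute)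
        then show ?thesis by (intro mult_right_mono mult_left_mono) auto
      qed
      finally have "c * (l - r) * norm (T x) \<le> c * (l - r) * (1 / 2 * norm x)" by (simp add: mult_ac)
      then show "norm (T x) \<le> 1 / 2 * norm x" using c rl by simp
    qed
    obtain N where N: "bounded_linear N" "\<And>x. N x - T (N x) = x" "\<And>x. N (x - T x) = x"
      "\<And>x. (\<lambda>k. (T ^^ k) x) sums N x"
      by (rule Neumann_series[OF T _ _ Tq]) (simp, simp, blast)
    have N_ge: "x \<le> N x" if "0 \<le> x" for x
    proof -
      have "0 \<le> T (N x)" by (intro Tpos Neumann_nonneg[OF Tpos N(4) that])
      moreover have "N x = x + T (N x)" using N(2)[of x] by (simp add: algebra_simps)
      ultimately show ?thesis by (metis le_add_same_cancel1)
    qed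
    have J_inj: "inj J"
    proof (rule injI)
      fix x y assume "J x = J y"
      then have "?R x = ?R y" using P(3) by metis
      then show "x = y" using resolvent_right[OF regl] by metis
    qed
    have PK: "P (K x) = l *\<^sub>R ?R x - (x - T x)" for x
      unfolding K_def P.add P(4) T_def by simp
    \<comment> \<open>The injective map \<open>P\<close> turns an equation in \<open>'b\<close> into
      one in \<open>'a\<close>: with \<open>z = l *\<^sub>R x - y\<close>, membership in the part
      reads \<open>x - T x = R(l) z\<close>. Hence the resolvent of the part is \<open>N\<close>
      after \<open>R(l)\<close>.\<close>
    have K_iff: "K x = J y \<longleftrightarrow> x - T x = ?R (l *\<^sub>R x - y)" for x y
    proof -
      have "K x = J y \<longleftrightarrow> P (K x) = P (J y)" using P(2) by (simp add: inj_eq)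
      also have "\<dots> \<longleftrightarrow> x - T x = ?R (l *\<^sub>R x - y)"
        unfolding PK P(3) linear_diff[OF Rlin] linear_scale[OF Rlin] by (auto simp: algebra_simps)
      finally show ?thesis .
    qed
    have A_eq: "x \<in> ?D" "?A x = y" if "K x = J y" for x y
      using that J_inj by (auto simp: part_dom_def part_op_def)
    have K_A: "K x = J (?A x)" if "x \<in> ?D" for x
      using that by (auto simp: part_dom_def part_op_def f_inv_into_f)
    have Klin: "linear K"
    proof (rule linearI)
      show "K (x + y) = K x + K y" for x y
        by (rule injD[OF P(2)])
          (simp add: P.add PK linear_add[OF Rlin] linear_add[OF T] algebra_simps)
      show "K (a *\<^sub>R x) = a *\<^sub>R K x" for a x
        by (rule injD[OF P(2)])
          (simp add: P.scaleR PK linear_scale[OF Rlin] linear_scale[OF T] algebra_simps)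
    qed
    have lin': "linear_operator ?D ?A"
      unfolding linear_operator_def subspace_def
    proof (intro conjI ballI allI)
      show "0 \<in> ?D"
        by (rule A_eq(1)[of 0 0]) (simp add: linear_0[OF Klin] linear_0[OF J])
      fix x y assume "x \<in> ?D" "y \<in> ?D"
      then have "K (x + y) = J (?A x + ?A y)"
        by (simp add: linear_add[OF Klin] linear_add[OF J] K_A)
      then show "x + y \<in> ?D" "?A (x + y) = ?A x + ?A y" by (rule A_eq)+
    next
      fix a x assume "x \<in> ?D"
      then have "K (a *\<^sub>R x) = J (a *\<^sub>R ?A x)"
        by (simp add: linear_scale[OF Klin] linear_scale[OF J] K_A)
      then show "a *\<^sub>R x \<in> ?D" "?A (a *\<^sub>R x) = a *\<^sub>R ?A x" by (rule A_eq)+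
    qed
    have NK: "K (N (?R z)) = J (l *\<^sub>R N (?R z) - z)" for z
      unfolding K_iff N(2) by simp
    have N_dom: "N (?R z) \<in> ?D" for z by (rule A_eq(1)[OF NK])
    have N_right: "l *\<^sub>R N (?R z) - ?A (N (?R z)) = z" for z
      using A_eq(2)[OF NK, of z] by simp
    have N_left: "N (?R (l *\<^sub>R x - ?A x)) = x" if "x \<in> ?D" for x
      using K_A[OF that] unfolding K_iff by (metis N(3))
    have "bounded_linear (\<lambda>x. N (?R x))"
      by (rule bounded_linear_compose[OF N(1) bounded_linear_resolvent[OF regl]])
    note reg' = regularI[OF N_dom N_right N_left this]
    have "surj N" by (rule surjI[of N "\<lambda>x. x - T x", OF N(3)])
    with N(1) N_ge N_dom reg' lin' show ?thesis by blast
  qed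
  have reg': "regular ?D ?A l" if "s \<le> l" for l using main[OF that] by blast
  have ge: "resolvent D A l x \<le> resolvent ?D ?A l x" if "s \<le> l" "0 \<le> x" for l x
    using main[OF that(1)] pos[of l x] that rs by fastforce
  have pos': "0 \<le> resolvent ?D ?A l x" if "s \<le> l" "0 \<le> x" for l x
    using ge[OF that] pos[of l x] that rs by (meson less_imp_le order_trans)
  have lin': "linear_operator ?D ?A" using main[OF order_refl] by blast
  \<comment> \<open>The domain of the part contains \<open>N\<close> applied to \<open>D\<close>,
    and a bounded surjection maps a dense set onto a dense set.\<close>
  have dense': "closure ?D = UNIV"
  proof -
    obtain N where N: "bounded_linear N" "surj N" "\<And>x. N (resolvent D A s x) \<in> ?D"
      using main[OF order_refl] by blast
    have "N d \<in> ?D" if "d \<in> D" for d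
      using N(3)[of "s *\<^sub>R d - A d"] resolvent_left[OF reg[OF less_imp_le[OF rs]] that] by simp
    then have "closure (N ` D) \<subseteq> closure ?D" by (intro closure_mono) auto
    moreover have "N ` closure D \<subseteq> closure (N ` D)"
      by (rule closure_bounded_linear_image_subset[OF N(1)])
    ultimately show ?thesis using N(2) dense by auto
  qed
  \<comment> \<open>The lower estimate of \<open>A\<close> is taken at \<open>s\<close>, where the
    perturbed resolvent exists; since that resolvent dominates \<open>R(s)\<close> on the cone, it
    inherits the constant.\<close>
  obtain c' where c': "0 < c'" "\<And>x. 0 \<le> x \<Longrightarrow> c' * norm x \<le> norm (resolvent D A s x)"
    using assms(6)[of s] r rs by auto
  have c'': "c' * norm x \<le> norm (resolvent ?D ?A s x)" if x: "0 \<le> x" for x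
    using c'(2)[OF x] norm_mono_nonneg[OF pos[OF less_imp_le[OF rs] x] ge[OF order_refl x]]
    by linarith
  obtain S where S: "generates ?D ?A S" "positive_semigroup S" "locally_bounded_semigroup S"
    using resolvent_positive_generates[OF lin' dense' reg' pos' c'(1) c''] by blast
  have "spectral_bound ?D ?A = growth_bound S"
    by (rule positive_semigroup_spectral_bound[OF S reg'[OF order_refl] pos'[OF order_refl] c'(1) c''])
  with S show ?thesis by blast
qed

end
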